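(* Let $\Bbbk$ be a field, let $S=\Bbbk[X]$ be a polynomial ring in a finite set of variables $X$ partitioned as $X = X_1\cup\cdots\cup X_r$, with the $\mathbb{N}^r$-grading in which each variable in $X_i$ has multidegree $e_i$, and let $T=\Bbbk[y_1,\ldots,y_r]$. For a function $\lambda:X\to\Bbbk$ let $p_\lambda: S\to T$ be the $\Bbbk$-algebra homomorphism sending each $x\in X_i$ to $\lambda(x)y_i$, for $i=1,\ldots,r$. Let $I\subseteq S$ be a multigraded (that is, $\mathbb{N}^r$-homogeneous) ideal containing an element of pure color $i$ for each $i=1,\ldots,r$. Then, for any function $\lambda:X\to\Bbbk$, the image $p_\lambda(I)$ is a monomial ideal. Moreover, let $\lambda$ be sufficiently general so that for each $i$ some element of pure color $i$ in $I$ has nonzero image under $p_\lambda$. If $J\subseteq T$ is an ideal containing the image $p_\lambda(I)$, then the regularity of $J$ is less than or equal to the regularity of $I$.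
   Context: $e_i\in\mathbb{N}^r$ is the $i$-th unit coordinate vector. An $\mathbb{N}^r$-homogeneous polynomial with multidegree $r_i e_i$, where $r_i$ is a positive integer, is said to have pure color $i$. Regularity: for a homogeneous ideal $I$ in a standard graded polynomial ring $R$, let $F_\bullet$ be a minimal graded free resolution of $I$ with terms $F_p=\bigoplus_{i\in\mathbb{Z}} R(-i)^{\beta_{p,i}}$. The ideal $I$ is $m$-regular if $i\le m+p$ for every nonzero $\beta_{p,i}$, and the regularity of $I$ is the least $m$ such that $I$ is $m$-regular. The regularity of the ideals $I\subseteq S$ and $J\subseteq T$ is taken with respect to total degree.
   Formalization: For arbitrary λ the image p_λ(I) need not be an ideal of T (e.g. λ=0, I=S); it is shown to be a monomial ideal of the ring p_λ(S) and to generate a monomial ideal of T. J is taken homogeneous for total degree, since regularity is defined only then. *)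

theory Defs
  imports "HOL-Library.Poly_Mapping" "HOL-Library.Extended_Real"
    "Jordan_Normal_Form.Matrix_Kernel"
begin

section \<open>Polynomials and ideals\<close>

text \<open>Monomials are identified with exponent vectors, polynomials with finitely supported
  functions from monomials to coefficients; multiplication is convolution.\<close>

type_synonym ('x, 'k) mpol = "('x \<Rightarrow>\<^sub>0 nat) \<Rightarrow>\<^sub>0 'k"

definition Const :: "'k::zero \<Rightarrow> ('x, 'k) mpol" where
  "Const a = Poly_Mapping.single 0 a"

definition Var :: "'x \<Rightarrow> ('x, 'k::zero_neq_one) mpol" where
  "Var x = Poly_Mapping.single (Poly_Mapping.single x 1) 1"

definition monomials :: "('x, 'k::zero_neq_one) mpol set" where
  "monomials = range (\<lambda>t. Poly_Mapping.single t 1)"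

text \<open>A commutative ring as a module over itself: \<open>ideal.subspace I\<close> says that \<open>I\<close> is an ideal
  and \<open>ideal.span B\<close> is the ideal generated by \<open>B\<close>.\<close>

global_interpretation ideal: Modules.module "(*) :: 'a::comm_ring_1 \<Rightarrow> 'a \<Rightarrow> 'a"
  by unfold_locales (simp_all add: algebra_simps)

text \<open>The ideal of a subring \<open>A\<close> generated by a subset \<open>G\<close> of \<open>A\<close>.\<close>

definition ideal_gen_in :: "'a::comm_ring_1 set \<Rightarrow> 'a set \<Rightarrow> 'a set" where
  "ideal_gen_in A G = {\<Sum>g\<in>F. a g * g | F a. finite F \<and> F \<subseteq> G \<and> a ` F \<subseteq> A}"

lemma ideal_gen_in_UNIV: "ideal_gen_in UNIV G = ideal.span G"
  by (auto simp: ideal_gen_in_def ideal.span_explicit)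

definition monomial_ideal_in :: "('x, 'k::field) mpol set \<Rightarrow> ('x, 'k) mpol set \<Rightarrow> bool" where
  "monomial_ideal_in A M \<longleftrightarrow> (\<exists>G. G \<subseteq> monomials \<inter> A \<and> M = ideal_gen_in A G)"

definition monomial_ideal :: "('x, 'k::field) mpol set \<Rightarrow> bool" where
  "monomial_ideal M \<longleftrightarrow> (\<exists>G. G \<subseteq> monomials \<and> M = ideal.span G)"

section \<open>Gradings\<close>

text \<open>A grading is given by the degrees of the monomials. The zero polynomial is homogeneous of
  every degree.\<close>

definition homogeneous :: "(('x \<Rightarrow>\<^sub>0 nat) \<Rightarrow> 'g) \<Rightarrow> 'g \<Rightarrow> ('x, 'k::zero) mpol \<Rightarrow> bool" where
  "homogeneous deg a f \<longleftrightarrow> (\<forall>t\<in>Poly_Mapping.keys f. deg t = a)"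

definition homogeneous_ideal ::
    "(('x \<Rightarrow>\<^sub>0 nat) \<Rightarrow> 'g) \<Rightarrow> ('x, 'k::field) mpol set \<Rightarrow> bool" where
  "homogeneous_ideal deg I \<longleftrightarrow>
    (\<exists>B. (\<forall>f\<in>B. \<exists>a. homogeneous deg a f) \<and> I = ideal.span B)"

text \<open>The total degree is integer-valued because the twists in a free resolution are integers.\<close>

definition total_degree :: "('x::finite \<Rightarrow>\<^sub>0 nat) \<Rightarrow> int" where
  "total_degree t = (\<Sum>x\<in>UNIV. int (Poly_Mapping.lookup t x))"

text \<open>A colouring \<open>c\<close> of the variables encodes the partition into the sets \<open>c -` {i}\<close>; the
  variable \<open>x\<close> has multidegree \<open>Poly_Mapping.single (c x) 1\<close>, the unit vector of its colour.\<close>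

definition multidegree :: "('x::finite \<Rightarrow> 'r) \<Rightarrow> ('x \<Rightarrow>\<^sub>0 nat) \<Rightarrow> ('r \<Rightarrow>\<^sub>0 nat)" where
  "multidegree c t = (\<Sum>x\<in>UNIV. Poly_Mapping.single (c x) (Poly_Mapping.lookup t x))"

definition pure_color :: "('x::finite \<Rightarrow> 'r) \<Rightarrow> 'r \<Rightarrow> ('x, 'k::zero) mpol \<Rightarrow> bool" where
  "pure_color c i f \<longleftrightarrow>
    f \<noteq> 0 \<and> (\<exists>n>0. homogeneous (multidegree c) (Poly_Mapping.single i n) f)"

section \<open>The specialization homomorphism\<close>

text \<open>The \<open>'k\<close>-algebra homomorphism with \<open>x \<mapsto> \<lambda>(x) y\<^bsub>c x\<^esub>\<close>, see the lemmas below.\<close>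

definition specialize ::
    "('x::finite \<Rightarrow> 'r) \<Rightarrow> ('x \<Rightarrow> 'k::field) \<Rightarrow> ('x, 'k) mpol \<Rightarrow> ('r, 'k) mpol" where
  "specialize c lam f = (\<Sum>t\<in>Poly_Mapping.keys f. Const (Poly_Mapping.lookup f t) *
      (\<Prod>x\<in>UNIV. (Const (lam x) * Var (c x)) ^ Poly_Mapping.lookup t x))"

lemma specialize_superset:
  assumes "finite K" "Poly_Mapping.keys f \<subseteq> K"
  shows "specialize c lam f = (\<Sum>t\<in>K. Const (Poly_Mapping.lookup f t) *
      (\<Prod>x\<in>UNIV. (Const (lam x) * Var (c x)) ^ Poly_Mapping.lookup t x))"
  unfolding specialize_def using assms
  by (intro sum.mono_neutral_left) (auto simp: in_keys_iff Const_def)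

lemma Const_add: "Const (a + b) = Const a + (Const b :: ('x, 'k::comm_ring_1) mpol)"
  by (simp add: Const_def single_add)

lemma specialize_add: "specialize c lam (f + g) = specialize c lam f + specialize c lam g"
proof -
  let ?K = "Poly_Mapping.keys f \<union> Poly_Mapping.keys g"
  have fin: "finite ?K" by simp
  have "Poly_Mapping.keys (f + g) \<subseteq> ?K" by (rule Poly_Mapping.keys_add)
  note fg = specialize_superset[OF fin this]
    and f = specialize_superset[OF fin Un_upper1]
    and g = specialize_superset[OF fin Un_upper2]
  show ?thesis
    unfolding fg f g lookup_add Const_add distrib_right sum.distrib by (rule refl)
qed

lemma specialize_single: "specialize c lam (Poly_Mapping.single t a) =
    Const a * (\<Prod>x\<in>UNIV. (Const (lam x) * Var (c x)) ^ Poly_Mapping.lookup t x)"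
proof -
  have "Poly_Mapping.keys (Poly_Mapping.single t a) \<subseteq> {t}" by simp
  from specialize_superset[OF _ this, of c lam] show ?thesis by simp
qed

lemma mpol_induct [case_names zero add_single]:
  fixes f :: "('x, 'k::comm_ring_1) mpol"
  assumes "P 0" and step: "\<And>f t a. P f \<Longrightarrow> P (Poly_Mapping.single t a + f)"
  shows "P f"
proof (induction f rule: update_induct)
  case (update f t a)
  have "Poly_Mapping.update t a f = Poly_Mapping.single t a + f"
    using update(1)
    by (intro poly_mapping_eqI)
      (auto simp: lookup_update lookup_add lookup_single when_def in_keys_iff)
  with step[OF update(3)] show ?case by simp
qed (rule assms(1))

lemma specialize_0: "specialize c lam 0 = 0"
  by (simp add: specialize_def)

lemma Const_mult: "Const (a * b) = Const a * (Const b :: ('x, 'k::comm_ring_1) mpol)"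
  by (simp add: Const_def mult_single)

lemma specialize_mult_single:
  "specialize c lam (Poly_Mapping.single s a * Poly_Mapping.single t b) =
    specialize c lam (Poly_Mapping.single s a) * specialize c lam (Poly_Mapping.single t b)"
  unfolding mult_single specialize_single lookup_add power_add prod.distrib Const_mult
  by (simp only: mult_ac)

lemma specialize_mult: "specialize c lam (f * g) = specialize c lam f * specialize c lam g"
proof (induction f rule: mpol_induct)
  case (add_single f s a)
  have "specialize c lam (Poly_Mapping.single s a * g) =
      specialize c lam (Poly_Mapping.single s a) * specialize c lam g"
    by (induction g rule: mpol_induct)
      (simp_all add: specialize_0 specialize_add specialize_mult_single distrib_left)
  with add_single show ?case by (simp add: distrib_right specialize_add)
qed (simp add: specialize_0)

lemma specialize_Const: "specialize c lam (Const a) = Const a"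
  by (simp add: specialize_single Const_def)

lemma specialize_Var:
  fixes c :: "'x::finite \<Rightarrow> 'r" and lam :: "'x \<Rightarrow> 'k::field"
  shows "specialize c lam (Var x) = Const (lam x) * Var (c x)"
proof -
  have "(\<Prod>z\<in>UNIV. (Const (lam z) * Var (c z)) ^
        Poly_Mapping.lookup (Poly_Mapping.single x (1::nat)) z)
      = (\<Prod>z\<in>UNIV. if z = x then Const (lam z) * Var (c z) else (1 :: ('r, 'k) mpol))"
    by (rule prod.cong) (auto simp: lookup_single when_def)
  then have "(\<Prod>z\<in>UNIV. (Const (lam z) * Var (c z)) ^
        Poly_Mapping.lookup (Poly_Mapping.single x (1::nat)) z)
      = (Const (lam x) * Var (c x) :: ('r, 'k) mpol)"
    by simp
  moreover have "Const 1 = (1 :: ('r, 'k) mpol)" by (simp add: Const_def)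
  ultimately show ?thesis unfolding Var_def[of x] specialize_single by simp
qed

section \<open>Minimal graded free resolutions and regularity\<close>

text \<open>A minimal graded free resolution
  \<open>\<dots> \<rightarrow> F\<^sub>2 \<rightarrow> F\<^sub>1 \<rightarrow> F\<^sub>0 \<rightarrow> I \<rightarrow> 0\<close>. The list \<open>b p\<close> consists of the degrees of
  the elements of a homogeneous basis of \<open>F\<^sub>p\<close>, so that \<open>F\<^sub>p\<close> is the direct sum of the
  \<open>R(-i)\<close> for \<open>i\<close> in \<open>b p\<close>. The augmentation \<open>F\<^sub>0 \<rightarrow> I\<close> is the scalar product with \<open>g\<close>, and the
  matrix \<open>\<phi> p\<close> represents \<open>F\<^bsub>p+1\<^esub> \<rightarrow> F\<^sub>p\<close>. The homogeneity conditions say that the maps have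
  degree \<open>0\<close>. The last condition is minimality: the image of \<open>F\<^bsub>p+1\<^esub>\<close> is contained in the
  product of \<open>F\<^sub>p\<close> with the ideal generated by the variables.\<close>

definition minimal_graded_free_resolution ::
    "('x::finite, 'k::field) mpol set \<Rightarrow> (nat \<Rightarrow> int list) \<Rightarrow> ('x, 'k) mpol vec \<Rightarrow>
      (nat \<Rightarrow> ('x, 'k) mpol mat) \<Rightarrow> bool" where
  "minimal_graded_free_resolution I b g \<phi> \<longleftrightarrow>
    g \<in> carrier_vec (length (b 0)) \<and>
    (\<forall>p. \<phi> p \<in> carrier_mat (length (b p)) (length (b (Suc p)))) \<and>
    (\<forall>j < length (b 0). homogeneous total_degree (b 0 ! j) (g $ j)) \<and>
    (\<forall>p. \<forall>i < length (b p). \<forall>j < length (b (Suc p)).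
       homogeneous total_degree (b (Suc p) ! j - b p ! i) (\<phi> p $$ (i, j))) \<and>
    I = {g \<bullet> v | v. v \<in> carrier_vec (length (b 0))} \<and>
    {v \<in> carrier_vec (length (b 0)). g \<bullet> v = 0} =
      {\<phi> 0 *\<^sub>v w | w. w \<in> carrier_vec (length (b 1))} \<and>
    (\<forall>p. mat_kernel (\<phi> p) =
      {\<phi> (Suc p) *\<^sub>v w | w. w \<in> carrier_vec (length (b (Suc (Suc p))))}) \<and>
    (\<forall>p. \<forall>i < length (b p). \<forall>j < length (b (Suc p)).
       \<phi> p $$ (i, j) \<in> ideal.span (range Var))"

definition graded_betti :: "(nat \<Rightarrow> int list) \<Rightarrow> nat \<Rightarrow> int \<Rightarrow> nat" where
  "graded_betti b p i = count_list (b p) i"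

text \<open>Minimal graded free resolutions of a homogeneous ideal exist and are unique up to
  isomorphism, so the choice of the resolution does not matter.\<close>

definition m_regular :: "int \<Rightarrow> ('x::finite, 'k::field) mpol set \<Rightarrow> bool" where
  "m_regular m I \<longleftrightarrow> (\<exists>b g \<phi>. minimal_graded_free_resolution I b g \<phi> \<and>
    (\<forall>p i. graded_betti b p i \<noteq> 0 \<longrightarrow> i \<le> m + int p))"

text \<open>The least \<open>m\<close> such that \<open>I\<close> is \<open>m\<close>-regular, taken in the extended reals: the value is
  \<open>-\<infinity>\<close> for the zero ideal, and an integer for every nonzero homogeneous ideal.\<close>

definition regularity :: "('x::finite, 'k::field) mpol set \<Rightarrow> ereal" where
  "regularity I = (INF m\<in>{m. m_regular m I}. ereal (real_of_int m))"

end

theory Submission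
  imports Defs
begin

text \<open>The first part is bookkeeping: the specialization maps a form of multidegree \<open>u\<close> to a scalar
  multiple of the monomial \<open>y\<^sup>u\<close>, so multihomogeneous generators of \<open>I\<close> become monomials.

  For the bound let \<open>m\<close> be such that \<open>I\<close> is \<open>m\<close>-regular. The proof goes through the statement
  that \<open>p(I)\<close>, and hence every larger ideal \<open>J\<close>, contains all forms of degree at least \<open>m\<close>, where
  \<open>p\<close> is the specialization.

  Why this is true of \<open>p(I)\<close> (lemmas \<open>null_homotopy\<close>, \<open>socle_degree_bound\<close>,
  \<open>forms_in_specialize_image\<close>): let \<open>F\<close> be the resolution of \<open>S/I\<close> and let \<open>G\<close> be its base change along
  \<open>p\<close>, a complex of free \<open>T\<close>-modules with \<open>H\<^sub>0(G) = T/p(I)\<close>. It need not be exact, but multiplication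
  by an element of \<open>I\<close> is null-homotopic on \<open>F\<close>, and homotopies survive base change, so \<open>p(I)\<close> acts
  as zero on the homology of \<open>G\<close> and of every quotient \<open>G/QG\<close>. By assumption \<open>p(I)\<close> contains a
  power \<open>z\<^sub>i\<close> of every variable \<open>y\<^sub>i\<close>. As \<open>z\<^sub>1, z\<^sub>2, \<dots>\<close> is a regular sequence, the long exact
  sequence of multiplication by \<open>z\<^sub>i\<close> turns a nonzero class of degree \<open>e\<close> in
  \<open>H\<^sub>q(G/(z\<^sub>1, \<dots>, z\<^bsub>i-1\<^esub>)G)\<close> into a nonzero class of degree \<open>e + deg z\<^sub>i\<close> in
  \<open>H\<^bsub>q+1\<^esub>(G/(z\<^sub>1, \<dots>, z\<^sub>i)G)\<close>. A form of degree \<open>d\<close> outside \<open>p(I)\<close> thus yields a nonzero element of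
  \<open>G\<^sub>r/(z\<^sub>1, \<dots>, z\<^sub>r)G\<^sub>r\<close> of degree \<open>d + \<Sum> deg z\<^sub>i\<close>. This module is zero in degrees larger than
  \<open>(m + r - 1) + \<Sum> (deg z\<^sub>i - 1) = m - 1 + \<Sum> deg z\<^sub>i\<close>, so \<open>d < m\<close>.

  Why containing all forms of degree at least \<open>m\<close> makes \<open>J\<close> an \<open>m\<close>-regular ideal (lemma
  \<open>m_regular_if_contains_forms\<close>): a minimal resolution has to be constructed, syzygy module by
  syzygy module. The induction carries a vanishing condition for Tor against quotients by sets of
  variables (\<open>tor_bounded\<close>), which shows that the \<open>p\<close>-th syzygy module is generated in degrees at
  most \<open>m + p\<close>. Since its graded pieces have finite dimension, it is finitely generated, and a
  generating list of minimal length gives the next step of a minimal resolution.\<close>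

section \<open>Homogeneous components of polynomials\<close>

lemma total_degree_add: "total_degree (s + t) = total_degree s + total_degree t"
  by (simp add: total_degree_def lookup_add sum.distrib)

lemma total_degree_nonneg: "0 \<le> total_degree t"
  by (simp add: total_degree_def sum_nonneg)

lemma total_degree_0 [simp]: "total_degree 0 = 0"
  by (simp add: total_degree_def)

lemma total_degree_single: "total_degree (Poly_Mapping.single x n) = int n"
  by (simp add: total_degree_def lookup_single when_def if_distrib[of int] cong: if_cong)

lemma total_degree_eq_0_iff: "total_degree t = 0 \<longleftrightarrow> t = 0"
  by (auto simp: total_degree_def sum_nonneg_eq_0_iff intro!: poly_mapping_eqI)

definition hcomp :: "int \<Rightarrow> ('x::finite, 'k::comm_ring_1) mpol \<Rightarrow> ('x, 'k) mpol" where
  "hcomp d f = Poly_Mapping.mapp (\<lambda>t a. a when total_degree t = d) f"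

lemma lookup_hcomp:
  "Poly_Mapping.lookup (hcomp d f) t = (Poly_Mapping.lookup f t when total_degree t = d)"
  by (simp add: hcomp_def lookup_mapp in_keys_iff when_def)

lemma homogeneous_iff_hcomp: "homogeneous total_degree d f \<longleftrightarrow> hcomp d f = f"
  by (auto simp: homogeneous_def poly_mapping_eq_iff fun_eq_iff lookup_hcomp in_keys_iff when_def)

lemma hcomp_hcomp: "hcomp d (hcomp e f) = (if d = e then hcomp d f else 0)"
  by (auto intro!: poly_mapping_eqI simp: lookup_hcomp when_def)

lemma hcomp_0 [simp]: "hcomp d 0 = 0"
  by (auto intro!: poly_mapping_eqI simp: lookup_hcomp)

lemma hcomp_add: "hcomp d (f + g) = hcomp d f + hcomp d g"
  by (auto intro!: poly_mapping_eqI simp: lookup_hcomp lookup_add when_add_distrib)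

lemma hcomp_diff: "hcomp d (f - g) = hcomp d f - hcomp d g"
  by (auto intro!: poly_mapping_eqI simp: lookup_hcomp lookup_minus when_diff_distrib)

lemma hcomp_sum: "hcomp d (\<Sum>i\<in>A. f i) = (\<Sum>i\<in>A. hcomp d (f i))"
  by (induction A rule: infinite_finite_induct) (simp_all add: hcomp_add)

lemma hcomp_single:
  "hcomp d (Poly_Mapping.single t a) = (if total_degree t = d then Poly_Mapping.single t a else 0)"
  by (auto intro!: poly_mapping_eqI simp: lookup_hcomp lookup_single when_def)

lemma hcomp_neg: "d < 0 \<Longrightarrow> hcomp d f = 0"
  using total_degree_nonneg
  by (fastforce intro!: poly_mapping_eqI simp: lookup_hcomp when_def not_le[symmetric])

lemma hcomp_hcomp_mult: "hcomp n (hcomp e f * g) = hcomp e f * hcomp (n - e) g"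
proof (induction f rule: mpol_induct)
  case (add_single f s a)
  have "hcomp n (hcomp e (Poly_Mapping.single s a) * g) =
      hcomp e (Poly_Mapping.single s a) * hcomp (n - e) g"
    by (induction g rule: mpol_induct)
      (auto simp: distrib_left hcomp_add hcomp_single mult_single total_degree_add)
  with add_single show ?case by (simp add: hcomp_add distrib_right)
qed simp

lemma hcomp_mult_homogeneous:
  assumes "homogeneous total_degree e f"
  shows "hcomp n (f * g) = f * hcomp (n - e) g"
  using hcomp_hcomp_mult[of n e f g] assms by (simp add: homogeneous_iff_hcomp)

section \<open>Homogeneous components of vectors\<close>

text \<open>A vector \<open>v\<close> of length \<open>length cs\<close> is an element of the free module \<open>\<Oplus>\<^sub>i R(-cs ! i)\<close>, in which
  the basis vector \<open>i\<close> has degree \<open>cs ! i\<close>; hence the shift of the degrees of the entries.\<close>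

definition hvcomp :: "int list \<Rightarrow> int \<Rightarrow> ('x::finite, 'k::comm_ring_1) mpol vec \<Rightarrow> ('x, 'k) mpol vec"
  where "hvcomp cs e v = vec (length cs) (\<lambda>i. hcomp (e - cs ! i) (v $ i))"

text \<open>The matrix of a homogeneous map of degree \<open>d\<close> from \<open>\<Oplus>\<^sub>j R(-bs ! j)\<close> to \<open>\<Oplus>\<^sub>i R(-cs ! i)\<close>.\<close>

definition hmat :: "int list \<Rightarrow> int list \<Rightarrow> int \<Rightarrow> ('x::finite, 'k::comm_ring_1) mpol mat \<Rightarrow> bool"
  where "hmat cs bs d M \<longleftrightarrow> M \<in> carrier_mat (length cs) (length bs) \<and>
    (\<forall>i < length cs. \<forall>j < length bs. homogeneous total_degree (d + bs ! j - cs ! i) (M $$ (i, j)))"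

lemma hmat_carrier: "hmat cs bs d M \<Longrightarrow> M \<in> carrier_mat (length cs) (length bs)"
  by (simp add: hmat_def)

lemma hvcomp_carrier [simp]: "hvcomp cs e v \<in> carrier_vec (length cs)"
  by (simp add: hvcomp_def)

lemma dim_hvcomp [simp]: "dim_vec (hvcomp cs e v) = length cs"
  by (simp add: hvcomp_def)

lemma hvcomp_index [simp]: "i < length cs \<Longrightarrow> hvcomp cs e v $ i = hcomp (e - cs ! i) (v $ i)"
  by (simp add: hvcomp_def)

lemma hvcomp_hvcomp: "hvcomp cs d (hvcomp cs e v) = (if d = e then hvcomp cs d v else 0\<^sub>v (length cs))"
  by (auto simp: hcomp_hcomp)

lemma hvcomp_idem [simp]: "hvcomp cs d (hvcomp cs d v) = hvcomp cs d v"
  by (simp add: hvcomp_hvcomp)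

lemma hvcomp_0 [simp]: "hvcomp cs d (0\<^sub>v (length cs)) = 0\<^sub>v (length cs)"
  by auto

lemma hvcomp_add:
  "\<lbrakk>v \<in> carrier_vec (length cs); w \<in> carrier_vec (length cs)\<rbrakk> \<Longrightarrow>
   hvcomp cs d (v + w) = hvcomp cs d v + hvcomp cs d w"
  by (auto simp: hcomp_add)

lemma hvcomp_diff:
  "\<lbrakk>v \<in> carrier_vec (length cs); w \<in> carrier_vec (length cs)\<rbrakk> \<Longrightarrow>
   hvcomp cs d (v - w) = hvcomp cs d v - hvcomp cs d w"
  by (auto simp: hcomp_diff)

lemma hvcomp_smult:
  "\<lbrakk>homogeneous total_degree e f; v \<in> carrier_vec (length cs)\<rbrakk> \<Longrightarrow>
   hvcomp cs d (f \<cdot>\<^sub>v v) = f \<cdot>\<^sub>v hvcomp cs (d - e) v"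
  by (auto simp: hcomp_mult_homogeneous algebra_simps)

lemma mult_mat_vec_index_sum:
  assumes "M \<in> carrier_mat nr nc" "v \<in> carrier_vec nc" "i < nr"
  shows "(M *\<^sub>v v) $ i = (\<Sum>j<nc. M $$ (i, j) * v $ j)"
  using assms by (auto simp: scalar_prod_def lessThan_atLeast0 intro!: sum.cong)

lemma mult_mat_smult_vec:
  assumes "M \<in> carrier_mat nr nc" "v \<in> carrier_vec nc"
  shows "M *\<^sub>v (f \<cdot>\<^sub>v v) = f \<cdot>\<^sub>v (M *\<^sub>v (v :: 'a::comm_ring_1 vec))"
  using assms by (intro eq_vecI) auto

text \<open>The entry in position \<open>(i, j)\<close> raises the degree of a polynomial by exactly
  \<open>d + bs ! j - cs ! i\<close>, so that all terms of an entry of the product are shifted alike.\<close>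

lemma hvcomp_mult_mat_vec:
  assumes M: "hmat cs bs d M" and v: "v \<in> carrier_vec (length bs)"
  shows "hvcomp cs e (M *\<^sub>v v) = M *\<^sub>v hvcomp bs (e - d) v"
proof (rule eq_vecI)
  note C = hmat_carrier[OF M]
  fix i assume "i < dim_vec (M *\<^sub>v hvcomp bs (e - d) v)"
  then have i: "i < length cs" using C by simp
  have "hcomp (e - cs ! i) (M $$ (i, j) * v $ j) = M $$ (i, j) * hcomp (e - d - bs ! j) (v $ j)"
    if "j < length bs" for j
  proof -
    have "homogeneous total_degree (d + bs ! j - cs ! i) (M $$ (i, j))"
      using M i that by (simp add: hmat_def)
    from hcomp_mult_homogeneous[OF this] show ?thesis by (simp add: algebra_simps)
  qed
  then show "hvcomp cs e (M *\<^sub>v v) $ i = (M *\<^sub>v hvcomp bs (e - d) v) $ i"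
    using i by (simp add: mult_mat_vec_index_sum[OF C v] hcomp_sum
      mult_mat_vec_index_sum[OF C hvcomp_carrier] del: index_mult_mat_vec)
qed (use hmat_carrier[OF M] in simp)

section \<open>Graded submodules of free modules\<close>

definition vec_submodule :: "nat \<Rightarrow> 'a::comm_ring_1 vec set \<Rightarrow> bool" where
  "vec_submodule n Z \<longleftrightarrow> Z \<subseteq> carrier_vec n \<and> 0\<^sub>v n \<in> Z \<and>
    (\<forall>v\<in>Z. \<forall>w\<in>Z. v + w \<in> Z) \<and> (\<forall>f. \<forall>v\<in>Z. f \<cdot>\<^sub>v v \<in> Z)"

definition graded_submodule :: "int list \<Rightarrow> ('x::finite, 'k::comm_ring_1) mpol vec set \<Rightarrow> bool" where
  "graded_submodule cs Z \<longleftrightarrow> vec_submodule (length cs) Z \<and> (\<forall>v\<in>Z. \<forall>e. hvcomp cs e v \<in> Z)"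

lemma submoduleD:
  assumes "vec_submodule n Z"
  shows "v \<in> Z \<Longrightarrow> v \<in> carrier_vec n" "0\<^sub>v n \<in> Z" "v \<in> Z \<Longrightarrow> w \<in> Z \<Longrightarrow> v + w \<in> Z"
    "v \<in> Z \<Longrightarrow> f \<cdot>\<^sub>v v \<in> Z"
  using assms by (auto simp: vec_submodule_def)

lemma submodule_diff:
  assumes Z: "vec_submodule n Z" and v: "v \<in> Z" and w: "w \<in> Z"
  shows "v - w \<in> Z"
proof -
  have "v - w = v + (-1) \<cdot>\<^sub>v w"
    using submoduleD(1)[OF Z v] submoduleD(1)[OF Z w] by (intro eq_vecI) auto
  with submoduleD[OF Z] v w show ?thesis by simp
qed

definition mat_range :: "'a::comm_ring_1 mat \<Rightarrow> 'a vec set" where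
  "mat_range M = {M *\<^sub>v v | v. v \<in> carrier_vec (dim_col M)}"

lemma mat_rangeE:
  assumes "v \<in> mat_range M" "M \<in> carrier_mat nr nc"
  obtains u where "u \<in> carrier_vec nc" "v = M *\<^sub>v u"
  using assms by (auto simp: mat_range_def)

lemma mat_rangeI: "M \<in> carrier_mat nr nc \<Longrightarrow> v \<in> carrier_vec nc \<Longrightarrow> M *\<^sub>v v \<in> mat_range M"
  by (auto simp: mat_range_def)

lemma submodule_mat_range:
  assumes M: "M \<in> carrier_mat nr nc"
  shows "vec_submodule nr (mat_range M)"
proof -
  have "0\<^sub>v nr = M *\<^sub>v 0\<^sub>v nc" using M by auto
  then have "0\<^sub>v nr \<in> mat_range M" using mat_rangeI[OF M] by simp
  moreover have "v + w \<in> mat_range M" if vw: "v \<in> mat_range M" "w \<in> mat_range M" for v w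
  proof -
    obtain x y where "x \<in> carrier_vec nc" "v = M *\<^sub>v x" "y \<in> carrier_vec nc" "w = M *\<^sub>v y"
      using vw M by (auto simp: mat_range_def)
    then show ?thesis using mat_rangeI[OF M, of "x + y"] by (simp add: mult_add_distrib_mat_vec[OF M])
  qed
  moreover have "f \<cdot>\<^sub>v v \<in> mat_range M" if v: "v \<in> mat_range M" for f v
  proof -
    obtain x where "x \<in> carrier_vec nc" "v = M *\<^sub>v x" using v M by (rule mat_rangeE)
    then show ?thesis using mat_rangeI[OF M, of "f \<cdot>\<^sub>v x"] by (simp add: mult_mat_smult_vec[OF M])
  qed
  moreover have "mat_range M \<subseteq> carrier_vec nr" using M by (auto simp: mat_range_def)
  ultimately show ?thesis by (simp add: vec_submodule_def)
qed

lemma submodule_kernel: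
  assumes M: "M \<in> carrier_mat nr nc"
  shows "vec_submodule nc (mat_kernel M)"
  unfolding mat_kernel[OF M] vec_submodule_def
  using M by (auto simp: mult_add_distrib_mat_vec[OF M] mult_mat_smult_vec[OF M])

lemma graded_submodule_kernel:
  assumes M: "hmat cs bs d M"
  shows "graded_submodule bs (mat_kernel M)"
proof -
  note C = hmat_carrier[OF M]
  have "hvcomp bs e v \<in> mat_kernel M" if "v \<in> mat_kernel M" for e v
    using that hvcomp_mult_mat_vec[OF M, of v "e + d"] by (auto simp: mat_kernel[OF C])
  then show ?thesis using submodule_kernel[OF C] by (simp add: graded_submodule_def)
qed

text \<open>A vector is the sum of its homogeneous components: peel them off one degree at a time.\<close>

lemma in_submodule_if_components:
  assumes W: "vec_submodule (length cs) W" and v: "v \<in> carrier_vec (length cs)"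
    and comp: "\<And>e. hvcomp cs e v \<in> W"
  shows "v \<in> W"
proof -
  have "u \<in> W" if "finite E" "u \<in> carrier_vec (length cs)" "\<And>e. hvcomp cs e u \<in> W"
      "\<And>i t. i < length cs \<Longrightarrow> t \<in> Poly_Mapping.keys (u $ i) \<Longrightarrow> total_degree t + cs ! i \<in> E" for u E
    using that
  proof (induction E arbitrary: u)
    case empty
    then have "Poly_Mapping.keys (u $ i) = {}" if "i < length cs" for i using that by blast
    then have "u = 0\<^sub>v (length cs)" using empty.prems(1) by (intro eq_vecI) auto
    then show ?case using submoduleD(2)[OF W] by simp
  next
    case (insert d E)
    let ?u = "u - hvcomp cs d u"
    have "?u \<in> W"
    proof (rule insert.IH)
      show "?u \<in> carrier_vec (length cs)" using insert.prems(1) by simp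
      show "hvcomp cs e ?u \<in> W" for e
        using insert.prems(1,2) submoduleD(2)[OF W]
        by (simp add: hvcomp_diff hvcomp_hvcomp submodule_diff[OF W])
      show "total_degree t + cs ! i \<in> E" if i: "i < length cs" and t: "t \<in> Poly_Mapping.keys (?u $ i)" for i t
      proof -
        have "Poly_Mapping.lookup (u $ i) t \<noteq> 0" "total_degree t \<noteq> d - cs ! i"
          using t i insert.prems(1) by (auto simp: in_keys_iff lookup_minus lookup_hcomp when_def split: if_splits)
        then show ?thesis using insert.prems(3)[OF i, of t] by (auto simp: in_keys_iff)
      qed
    qed
    moreover have "u = ?u + hvcomp cs d u" using insert.prems(1) by (intro eq_vecI) auto
    ultimately show ?case using submoduleD(3)[OF W] insert.prems(2)[of d] by metis
  qed
  note * = this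
  let ?E = "\<Union>i<length cs. (\<lambda>t. total_degree t + cs ! i) ` Poly_Mapping.keys (v $ i)"
  show ?thesis by (rule *[of ?E]) (use v comp in auto)
qed

lemma col_in_mat_range:
  assumes M: "M \<in> carrier_mat nr nc" and j: "j < nc"
  shows "col M j \<in> mat_range M"
proof -
  have "M *\<^sub>v unit_vec nc j = col M j" using M j by (intro eq_vecI) auto
  then show ?thesis using mat_rangeI[OF M, of "unit_vec nc j"] by simp
qed

lemma mult_eq_0_if_exact:
  assumes M: "M \<in> carrier_mat nr n" and N: "N \<in> carrier_mat n nc"
    and exact: "mat_kernel M = mat_range N"
  shows "M * N = 0\<^sub>m nr nc"
proof (rule mat_col_eqI)
  fix j assume "j < dim_col (0\<^sub>m nr nc :: 'a mat)"
  then have j: "j < nc" by simp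
  have "col N j \<in> mat_kernel M" unfolding exact by (rule col_in_mat_range[OF N j])
  then show "col (M * N) j = col (0\<^sub>m nr nc) j"
    using j mat_kernelD(2)[OF M] by (simp add: col_mult2[OF M N j])
qed (use M N in auto)

text \<open>By linearity a submodule that contains the columns of a matrix contains its range; the
  induction is over the support of the coefficient vector.\<close>

lemma range_subset_submodule:
  assumes M: "M \<in> carrier_mat nr nc" and W: "vec_submodule nr W"
    and cols: "\<And>j. j < nc \<Longrightarrow> col M j \<in> W" and v: "v \<in> carrier_vec nc"
  shows "M *\<^sub>v v \<in> W"
proof -
  have "M *\<^sub>v v \<in> W" if "finite S" "v \<in> carrier_vec nc" "\<And>j. j < nc \<Longrightarrow> j \<notin> S \<Longrightarrow> v $ j = 0" for S v
    using that
  proof (induction S arbitrary: v)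
    case empty
    then have "v = 0\<^sub>v nc" by (intro eq_vecI) auto
    then have "M *\<^sub>v v = 0\<^sub>v nr" using M by auto
    then show ?case using submoduleD(2)[OF W] by simp
  next
    case (insert j S)
    show ?case
    proof (cases "j < nc")
      case True
      let ?u = "v - v $ j \<cdot>\<^sub>v unit_vec nc j"
      have "M *\<^sub>v ?u \<in> W" by (rule insert.IH) (use insert.prems True in auto)
      moreover have "M *\<^sub>v unit_vec nc j = col M j"
        using M True by (intro eq_vecI) (auto simp: scalar_prod_right_unit)
      moreover have "M *\<^sub>v v = M *\<^sub>v (?u + v $ j \<cdot>\<^sub>v unit_vec nc j)"
        using insert.prems(1) by (intro arg_cong[where f = "mult_mat_vec M"] eq_vecI) auto
      then have "M *\<^sub>v v = M *\<^sub>v ?u + v $ j \<cdot>\<^sub>v (M *\<^sub>v unit_vec nc j)"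
        using insert.prems(1) by (simp add: mult_add_distrib_mat_vec[OF M] mult_mat_smult_vec[OF M])
      ultimately show ?thesis using submoduleD[OF W] cols[OF True] by simp
    next
      case False
      then have "v $ i = 0" if "i < nc" "i \<notin> S" for i
        using insert.prems(2)[OF that(1)] that by (cases "i = j") auto
      then show ?thesis using insert.prems(1) by (intro insert.IH) auto
    qed
  qed
  from this[of "{..<nc}"] v show ?thesis by auto
qed

section \<open>Ideals generated by powers of variables\<close>

text \<open>The ideal generated by the powers \<open>y\<^sub>j ^ a j\<close> for \<open>j\<close> in \<open>A\<close>, described by its monomials.\<close>

definition power_ideal :: "('r::finite \<Rightarrow> nat) \<Rightarrow> 'r set \<Rightarrow> ('r, 'k::comm_ring_1) mpol set" where
  "power_ideal a A = {f. \<forall>t\<in>Poly_Mapping.keys f. \<exists>j\<in>A. a j \<le> Poly_Mapping.lookup t j}"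

definition vpow :: "'r::finite \<Rightarrow> nat \<Rightarrow> ('r, 'k::comm_ring_1) mpol" where
  "vpow k n = Poly_Mapping.single (Poly_Mapping.single k n) 1"

lemma homogeneous_vpow: "homogeneous total_degree (int n) (vpow k n)"
  by (simp add: homogeneous_def vpow_def total_degree_single)

lemma mpol_eq_sum_terms:
  "(f :: ('x, 'k::comm_ring_1) mpol) =
    (\<Sum>t\<in>Poly_Mapping.keys f. Poly_Mapping.single t (Poly_Mapping.lookup f t))"
proof (rule poly_mapping_eqI)
  fix s
  have "(\<Sum>t\<in>Poly_Mapping.keys f. Poly_Mapping.lookup f t when t = s) = Poly_Mapping.lookup f s"
    by (simp add: when_def sum.delta in_keys_iff)
  then show "Poly_Mapping.lookup f s = Poly_Mapping.lookup
      (\<Sum>t\<in>Poly_Mapping.keys f. Poly_Mapping.single t (Poly_Mapping.lookup f t)) s"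
    by (simp add: lookup_sum lookup_single)
qed

lemma lookup_single_mult:
  "Poly_Mapping.lookup (Poly_Mapping.single s 1 * (f :: ('x, 'k::comm_ring_1) mpol)) (s + t) =
    Poly_Mapping.lookup f t"
  by (induction f rule: mpol_induct)
    (simp_all add: distrib_left lookup_add mult_single lookup_single)

lemma power_ideal_0 [simp]: "0 \<in> power_ideal a A"
  by (simp add: power_ideal_def)

lemma power_ideal_empty: "power_ideal a {} = {0}"
  by (auto simp: power_ideal_def)

lemma power_ideal_add: "f \<in> power_ideal a A \<Longrightarrow> g \<in> power_ideal a A \<Longrightarrow> f + g \<in> power_ideal a A"
  using Poly_Mapping.keys_add[of f g] by (auto simp: power_ideal_def)

lemma power_ideal_mult:
  assumes "f \<in> power_ideal a A" shows "g * f \<in> power_ideal a A"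
  unfolding power_ideal_def
proof (intro CollectI ballI)
  fix t assume "t \<in> Poly_Mapping.keys (g * f)"
  with Poly_Mapping.keys_mult[of g f] obtain u s where t: "t = u + s" "s \<in> Poly_Mapping.keys f" by auto
  with assms obtain j where "j \<in> A" "a j \<le> Poly_Mapping.lookup s j" by (auto simp: power_ideal_def)
  with t show "\<exists>j\<in>A. a j \<le> Poly_Mapping.lookup t j" by (auto simp: lookup_add intro!: bexI[of _ j])
qed

lemma power_ideal_sum: "(\<And>i. i \<in> S \<Longrightarrow> f i \<in> power_ideal a A) \<Longrightarrow> (\<Sum>i\<in>S. f i) \<in> power_ideal a A"
  by (induction S rule: infinite_finite_induct) (auto intro: power_ideal_add)

lemma power_ideal_hcomp: "f \<in> power_ideal a A \<Longrightarrow> hcomp d f \<in> power_ideal a A"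
  by (auto simp: power_ideal_def in_keys_iff lookup_hcomp)

lemma power_ideal_mono: "A \<subseteq> A' \<Longrightarrow> power_ideal a A \<subseteq> power_ideal a A'"
  by (fastforce simp: power_ideal_def)

lemma vpow_in_power_ideal: "k \<in> A \<Longrightarrow> vpow k (a k) \<in> power_ideal a A"
  by (auto simp: power_ideal_def vpow_def intro!: bexI[of _ k])

text \<open>Collect the monomials that are divisible by the power of the new variable, and divide them
  by it.\<close>

lemma power_ideal_insertE:
  fixes f :: "('r::finite, 'k::comm_ring_1) mpol"
  assumes f: "f \<in> power_ideal a (insert k A)"
  obtains h r where "f = vpow k (a k) * h + r" "r \<in> power_ideal a A"
proof -
  let ?K = "Poly_Mapping.keys f" and ?c = "Poly_Mapping.lookup f"
  let ?P = "\<lambda>t. a k \<le> Poly_Mapping.lookup t k"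
  let ?h = "\<Sum>t\<in>{t\<in>?K. ?P t}. Poly_Mapping.single (t - Poly_Mapping.single k (a k)) (?c t)"
  let ?r = "\<Sum>t\<in>{t\<in>?K. \<not> ?P t}. Poly_Mapping.single t (?c t)"
  have eq: "Poly_Mapping.single k (a k) + (t - Poly_Mapping.single k (a k)) = t" if "?P t" for t
    using that by (intro poly_mapping_eqI) (auto simp: lookup_add lookup_minus lookup_single when_def)
  have "vpow k (a k) * ?h = (\<Sum>t\<in>{t\<in>?K. ?P t}. Poly_Mapping.single t (?c t))"
    unfolding sum_distrib_left vpow_def by (rule sum.cong) (auto simp: mult_single eq)
  moreover have "(\<Sum>t\<in>?K. Poly_Mapping.single t (?c t)) =
      (\<Sum>t\<in>{t\<in>?K. ?P t} \<union> {t\<in>?K. \<not> ?P t}. Poly_Mapping.single t (?c t))"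
    by (rule sum.cong) auto
  then have "f = (\<Sum>t\<in>{t\<in>?K. ?P t}. Poly_Mapping.single t (?c t)) + ?r"
    using mpol_eq_sum_terms[of f] by (subst (asm) sum.union_disjoint) auto
  moreover have "?r \<in> power_ideal a A"
    using f by (intro power_ideal_sum) (auto simp: power_ideal_def)
  ultimately show ?thesis by (intro that[of ?h ?r]) simp_all
qed

text \<open>The powers of the variables form a regular sequence: multiplication by \<open>y\<^sub>k ^ n\<close> leaves the
  exponents of all other variables unchanged.\<close>

lemma power_ideal_cancel:
  assumes "vpow k n * f \<in> power_ideal a A" "k \<notin> A"
  shows "f \<in> power_ideal a A"
  unfolding power_ideal_def
proof (intro CollectI ballI)
  fix t assume "t \<in> Poly_Mapping.keys f"
  then have "Poly_Mapping.single k n + t \<in> Poly_Mapping.keys (vpow k n * f)"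
    by (simp add: in_keys_iff vpow_def lookup_single_mult)
  with assms(1) obtain j where "j \<in> A" "a j \<le> Poly_Mapping.lookup (Poly_Mapping.single k n + t) j"
    by (auto simp: power_ideal_def)
  with assms(2) show "\<exists>j\<in>A. a j \<le> Poly_Mapping.lookup t j"
    by (auto simp: lookup_add lookup_single when_def intro!: bexI[of _ j] split: if_splits)
qed

text \<open>The quotient by all \<open>y\<^sub>j ^ a j\<close> is spanned by the monomials with exponents at most \<open>a j - 1\<close>, and
  the bound is the degree of the largest of them.\<close>

lemma high_degree_in_power_ideal:
  assumes f: "homogeneous total_degree d f" and d: "d > (\<Sum>j\<in>UNIV. int (a j) - 1)"
  shows "f \<in> power_ideal a UNIV"
  unfolding power_ideal_def
proof (intro CollectI ballI, rule ccontr)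
  fix t assume t: "t \<in> Poly_Mapping.keys f" and "\<not> (\<exists>j\<in>UNIV. a j \<le> Poly_Mapping.lookup t j)"
  then have "int (Poly_Mapping.lookup t j) \<le> int (a j) - 1" for j
    by (auto simp: not_le dest: spec[of _ j])
  then have "total_degree t \<le> (\<Sum>j\<in>UNIV. int (a j) - 1)"
    unfolding total_degree_def by (intro sum_mono)
  with t f d show False by (auto simp: homogeneous_def)
qed

lemma mult_in_power_ideal: "f \<in> power_ideal a A \<Longrightarrow> f * g \<in> power_ideal a A"
  using power_ideal_mult[of f a A g] by (simp add: mult.commute)

definition vec_in :: "nat \<Rightarrow> 'a set \<Rightarrow> 'a vec set" where
  "vec_in n R = {v \<in> carrier_vec n. \<forall>i < n. v $ i \<in> R}"

lemma submodule_vec_in: "vec_submodule n (vec_in n (power_ideal a A))"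
  by (auto simp: vec_submodule_def vec_in_def intro!: power_ideal_add power_ideal_mult)

lemma mult_mat_vec_in:
  assumes M: "M \<in> carrier_mat nr nc" and v: "v \<in> vec_in nc (power_ideal a A)"
  shows "M *\<^sub>v v \<in> vec_in nr (power_ideal a A)"
  unfolding vec_in_def using M v
  by (auto simp: vec_in_def mult_mat_vec_index_sum[OF M] simp del: index_mult_mat_vec
    intro!: power_ideal_sum power_ideal_mult mult_mat_vec_carrier)

lemma vpow_smult_in:
  "k \<in> A \<Longrightarrow> v \<in> carrier_vec n \<Longrightarrow> vpow k (a k) \<cdot>\<^sub>v v \<in> vec_in n (power_ideal a A)"
  by (auto simp: vec_in_def intro!: mult_in_power_ideal vpow_in_power_ideal)

lemma vec_in_mono: "A \<subseteq> A' \<Longrightarrow> vec_in n (power_ideal a A) \<subseteq> vec_in n (power_ideal a A')"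
  using power_ideal_mono[of A A' a] by (auto simp: vec_in_def)

lemma vec_in_empty: "vec_in n (power_ideal a {}) = {0\<^sub>v n}"
  by (auto simp: vec_in_def power_ideal_empty)

lemma vec_in_hvcomp:
  "v \<in> vec_in (length cs) (power_ideal a A) \<Longrightarrow> hvcomp cs e v \<in> vec_in (length cs) (power_ideal a A)"
  by (auto simp: vec_in_def power_ideal_hcomp)

lemma vec_in_cancel:
  assumes "vpow k (a k) \<cdot>\<^sub>v v \<in> vec_in n (power_ideal a A)" "k \<notin> A"
  shows "v \<in> vec_in n (power_ideal a A)"
proof -
  have w: "vpow k (a k) \<cdot>\<^sub>v v \<in> carrier_vec n"
      "\<forall>i<n. (vpow k (a k) \<cdot>\<^sub>v v) $ i \<in> power_ideal a A"
    using assms(1) unfolding vec_in_def by blast+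
  from w(1) have v: "v \<in> carrier_vec n" by (metis carrier_vecD carrier_vecI index_smult_vec(2))
  have "v $ i \<in> power_ideal a A" if "i < n" for i
  proof -
    have "vpow k (a k) * v $ i \<in> power_ideal a A" using w(2) v that by (metis carrier_vecD index_smult_vec(1))
    then show ?thesis using assms(2) by (rule power_ideal_cancel)
  qed
  with v show ?thesis unfolding vec_in_def by blast
qed

lemma vec_in_insertE:
  assumes v: "v \<in> vec_in n (power_ideal a (insert k A))"
  obtains h r where "v = vpow k (a k) \<cdot>\<^sub>v h + r" "h \<in> carrier_vec n" "r \<in> vec_in n (power_ideal a A)"
proof -
  have "\<forall>i\<in>{..<n}. \<exists>p. v $ i = vpow k (a k) * fst p + snd p \<and> snd p \<in> power_ideal a A"
  proof
    fix i assume "i \<in> {..<n}"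
    with v have "v $ i \<in> power_ideal a (insert k A)" by (auto simp: vec_in_def)
    then obtain h r where "v $ i = vpow k (a k) * h + r" "r \<in> power_ideal a A"
      by (rule power_ideal_insertE)
    then show "\<exists>p. v $ i = vpow k (a k) * fst p + snd p \<and> snd p \<in> power_ideal a A"
      by (intro exI[of _ "(h, r)"]) simp
  qed
  then obtain q where q: "\<forall>i\<in>{..<n}. v $ i = vpow k (a k) * fst (q i) + snd (q i) \<and> snd (q i) \<in> power_ideal a A"
    by (rule bchoice[THEN exE])
  show ?thesis
    by (rule that[of "vec n (\<lambda>i. fst (q i))" "vec n (\<lambda>i. snd (q i))"])
      (use q v in \<open>auto simp: vec_in_def\<close>)
qed

section \<open>Lifting along homogeneous matrices\<close>

lemma hmat_iff_cols:
  "hmat cs bs d M \<longleftrightarrow> M \<in> carrier_mat (length cs) (length bs) \<and>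
    (\<forall>j < length bs. hvcomp cs (d + bs ! j) (col M j) = col M j)"
proof (cases "M \<in> carrier_mat (length cs) (length bs)")
  case True
  have "hvcomp cs (d + bs ! j) (col M j) = col M j \<longleftrightarrow>
      (\<forall>i < length cs. homogeneous total_degree (d + bs ! j - cs ! i) (M $$ (i, j)))"
    if "j < length bs" for j
    using True that by (auto simp: homogeneous_iff_hcomp vec_eq_iff)
  with True show ?thesis by (auto simp: hmat_def)
qed (simp add: hmat_def)

lemma hmat_mult:
  assumes M: "hmat cs bs d M" and N: "hmat bs as e N"
  shows "hmat cs as (d + e) (M * N)"
proof -
  note C = hmat_carrier[OF M] hmat_carrier[OF N]
  have "hvcomp cs (d + e + as ! j) (col (M * N) j) = col (M * N) j" if j: "j < length as" for j
  proof -
    have "col N j \<in> carrier_vec (length bs)" using C(2) j by simp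
    from hvcomp_mult_mat_vec[OF M this, of "d + e + as ! j"] show ?thesis
      using N j by (simp add: col_mult2[OF C j] hmat_iff_cols[of bs] algebra_simps)
  qed
  then show ?thesis using C by (simp add: hmat_iff_cols[of cs])
qed

lemma hmat_diff: "hmat cs bs d M \<Longrightarrow> hmat cs bs d N \<Longrightarrow> hmat cs bs d (M - N)"
  by (auto simp: hmat_def homogeneous_iff_hcomp hcomp_diff)

lemma hmat_scalar: "homogeneous total_degree d f \<Longrightarrow> hmat bs bs d (f \<cdot>\<^sub>m 1\<^sub>m (length bs))"
  by (auto simp: hmat_def homogeneous_def)

lemma scalar_mat_mult_vec:
  assumes "v \<in> carrier_vec n"
  shows "(f \<cdot>\<^sub>m 1\<^sub>m n) *\<^sub>v v = f \<cdot>\<^sub>v (v :: 'a::comm_ring_1 vec)"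
proof (rule eq_vecI)
  fix i assume "i < dim_vec (f \<cdot>\<^sub>v v)"
  then have "i < n" using assms by simp
  moreover from this have "row (f \<cdot>\<^sub>m 1\<^sub>m n) i = f \<cdot>\<^sub>v unit_vec n i" by (intro eq_vecI) auto
  ultimately show "((f \<cdot>\<^sub>m 1\<^sub>m n) *\<^sub>v v) $ i = (f \<cdot>\<^sub>v v) $ i" using assms by simp
qed (use assms in simp)

text \<open>Free modules are projective, in the graded category: lift the columns one by one and keep
  the component of the right degree.\<close>

lemma hmat_lift:
  assumes D: "hmat cs bs 0 D" and N: "hmat cs as d N"
    and cols: "\<And>j. j < length as \<Longrightarrow> col N j \<in> mat_range D"
  obtains S where "hmat bs as d S" "D * S = N"
proof -
  note C = hmat_carrier[OF D] hmat_carrier[OF N]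
  have "\<forall>j\<in>{..<length as}. \<exists>u. u \<in> carrier_vec (length bs) \<and> hvcomp bs (d + as ! j) u = u \<and> D *\<^sub>v u = col N j"
  proof
    fix j assume "j \<in> {..<length as}"
    then have j: "j < length as" by simp
    then obtain u where u: "u \<in> carrier_vec (length bs)" "col N j = D *\<^sub>v u"
      using mat_rangeE[OF cols[OF j] C(1)] by metis
    have "D *\<^sub>v hvcomp bs (d + as ! j) u = hvcomp cs (d + as ! j) (col N j)"
      using hvcomp_mult_mat_vec[OF D u(1), of "d + as ! j"] u(2) by simp
    also have "\<dots> = col N j" using N j by (simp add: hmat_iff_cols)
    finally show "\<exists>u. u \<in> carrier_vec (length bs) \<and> hvcomp bs (d + as ! j) u = u \<and> D *\<^sub>v u = col N j"
      by (intro exI[of _ "hvcomp bs (d + as ! j) u"]) simp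
  qed
  then obtain u where u: "\<And>j. j < length as \<Longrightarrow>
      u j \<in> carrier_vec (length bs) \<and> hvcomp bs (d + as ! j) (u j) = u j \<and> D *\<^sub>v u j = col N j"
    by (metis lessThan_iff)
  define S where "S = mat (length bs) (length as) (\<lambda>(i, j). u j $ i)"
  have S: "S \<in> carrier_mat (length bs) (length as)" by (simp add: S_def)
  have col: "col S j = u j" if "j < length as" for j
    using u[OF that] that by (intro eq_vecI) (auto simp: S_def)
  show ?thesis
  proof (rule that)
    show "hmat bs as d S" using S u by (simp add: hmat_iff_cols col)
    show "D * S = N"
    proof (rule mat_col_eqI)
      fix j assume "j < dim_col N"
      then have j: "j < length as" using C by simp
      show "col (D * S) j = col N j" using col_mult2[OF C(1) S j] u[OF j] col[OF j] by simp
    qed (use C S in auto)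
  qed
qed

section \<open>Multiplication by an element of the ideal is null-homotopic\<close>

text \<open>On a free resolution of \<open>S/I\<close> every \<open>f\<close> in \<open>I\<close> acts by a map that is homotopic to zero,
  because it induces the zero map on \<open>S/I\<close>. Since a homotopy consists of matrices that satisfy
  polynomial identities, it survives every base change; this is how information about the
  resolution of \<open>I\<close> is transported to the image of \<open>I\<close> in another ring.\<close>

lemma null_homotopy:
  fixes D :: "nat \<Rightarrow> ('x::finite, 'k::field) mpol mat"
  assumes D: "\<And>p. hmat (B p) (B (Suc p)) 0 (D p)"
    and exact: "\<And>p. mat_kernel (D p) = mat_range (D (Suc p))"
    and f: "homogeneous total_degree d f"
    and fI: "\<And>j. j < length (B 0) \<Longrightarrow> col (f \<cdot>\<^sub>m 1\<^sub>m (length (B 0))) j \<in> mat_range (D 0)"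
  obtains s where "\<And>p. hmat (B (Suc p)) (B p) d (s p)"
    "D 0 * s 0 = f \<cdot>\<^sub>m 1\<^sub>m (length (B 0))"
    "\<And>p. D (Suc p) * s (Suc p) + s p * D p = f \<cdot>\<^sub>m 1\<^sub>m (length (B (Suc p)))"
proof -
  let ?l = "\<lambda>p. length (B p)"
  note C = hmat_carrier[OF D]
  have DD: "D p * D (Suc p) = 0\<^sub>m (?l p) (?l (Suc (Suc p)))" for p
    by (rule mult_eq_0_if_exact[OF C C exact])
  \<comment> \<open>The conjunct \<open>D p * S * D p = f \<cdot>\<^sub>m D p\<close> is what makes the next homotopy exist: it says
      that \<open>f - S * D p\<close> maps into the kernel of \<open>D p\<close>.\<close>
  define P where "P p S \<longleftrightarrow> hmat (B (Suc p)) (B p) d S \<and> D p * S * D p = f \<cdot>\<^sub>m D p \<and>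
    (p = 0 \<longrightarrow> D 0 * S = f \<cdot>\<^sub>m 1\<^sub>m (?l 0))" for p S
  define Q where "Q p S S' \<longleftrightarrow> D (Suc p) * S' + S * D p = f \<cdot>\<^sub>m 1\<^sub>m (?l (Suc p))" for p S S'
  have "\<exists>s. \<forall>p. P p (s p) \<and> Q p (s p) (s (Suc p))"
  proof (rule dependent_nat_choice)
    obtain S where S: "hmat (B (Suc 0)) (B 0) d S" "D 0 * S = f \<cdot>\<^sub>m 1\<^sub>m (?l 0)"
      using hmat_lift[OF D hmat_scalar[OF f] fI] by blast
    then have "P 0 S" using C[of 0] by (simp add: P_def mult_smult_assoc_mat[of _ "?l 0" "?l 0" _ "?l 1"])
    then show "\<exists>S. P 0 S" ..
  next
    fix S p assume "P p S"
    then have S: "hmat (B (Suc p)) (B p) d S" and SD: "D p * S * D p = f \<cdot>\<^sub>m D p"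
      by (auto simp: P_def)
    note CS = hmat_carrier[OF S]
    let ?one = "f \<cdot>\<^sub>m 1\<^sub>m (?l (Suc p))"
    let ?N = "?one - S * D p"
    have SDp: "S * D p \<in> carrier_mat (?l (Suc p)) (?l (Suc p))" using CS C[of p] by simp
    have N: "hmat (B (Suc p)) (B (Suc p)) d ?N"
      using hmat_mult[OF S D[of p]] hmat_scalar[OF f] by (intro hmat_diff) auto
    note CN = hmat_carrier[OF N]
    have DN: "D p * ?N = 0\<^sub>m (?l p) (?l (Suc p))"
    proof -
      have "D p * ?N = D p * ?one - D p * (S * D p)"
        using C[of p] SDp by (intro mult_minus_distrib_mat) auto
      also have "D p * (S * D p) = D p * S * D p"
        using C[of p] CS by (intro assoc_mult_mat[symmetric]) auto
      also have "D p * ?one = f \<cdot>\<^sub>m D p"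
        using C[of p] by (simp add: mult_smult_distrib[of _ "?l p" "?l (Suc p)" _ "?l (Suc p)"])
      finally show ?thesis using SD C[of p] by auto
    qed
    have "col ?N j \<in> mat_range (D (Suc p))" if j: "j < ?l (Suc p)" for j
    proof -
      have "D p *\<^sub>v col ?N j = 0\<^sub>v (?l p)"
        using arg_cong[OF DN, of "\<lambda>M. col M j"] j by (simp add: col_mult2[OF C CN])
      then show ?thesis using CN j unfolding exact[symmetric] by (intro mat_kernelI[OF C]) auto
    qed
    then obtain S' where S': "hmat (B (Suc (Suc p))) (B (Suc p)) d S'" "D (Suc p) * S' = ?N"
      using hmat_lift[OF D N] by blast
    note CS' = hmat_carrier[OF S'(1)]
    have "D (Suc p) * S' * D (Suc p) = ?one * D (Suc p) - S * D p * D (Suc p)"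
      unfolding S' using C[of "Suc p"] SDp by (intro minus_mult_distrib_mat) auto
    also have "S * D p * D (Suc p) = S * (D p * D (Suc p))"
      using C[of p] C[of "Suc p"] CS by (intro assoc_mult_mat) auto
    also have "\<dots> = 0\<^sub>m (?l (Suc p)) (?l (Suc (Suc p)))" unfolding DD using CS by simp
    also have "?one * D (Suc p) = f \<cdot>\<^sub>m D (Suc p)"
      using C[of "Suc p"] by (simp add: mult_smult_assoc_mat[of _ "?l (Suc p)" "?l (Suc p)" _ "?l (Suc (Suc p))"])
    finally have "D (Suc p) * S' * D (Suc p) = f \<cdot>\<^sub>m D (Suc p)" using C[of "Suc p"] by auto
    moreover have "D (Suc p) * S' + S * D p = ?one" unfolding S' using SDp by (intro eq_matI) (auto simp del: index_mult_mat)
    ultimately show "\<exists>S'. P (Suc p) S' \<and> Q p S S'" using S' by (auto simp: P_def Q_def)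
  qed
  then obtain s where "\<And>p. P p (s p)" "\<And>p. Q p (s p) (s (Suc p))" by blast
  then show ?thesis by (intro that[of s]) (auto simp: P_def Q_def)
qed

section \<open>Degrees that vanish modulo the ideal\<close>

text \<open>The class of \<open>w\<close> is pushed up the complex one variable at a time. The induction over the set \<open>A\<close> of
  variables treated so far produces \<open>g\<close> in homological degree \<open>card A\<close> that is a cycle but not a boundary
  modulo the powers of the variables in \<open>A\<close>. The homotopy \<open>s k\<close> for the next variable \<open>k\<close> gives the
  new element \<open>s k g\<close>, whose boundary is \<open>y\<^sub>k ^ a k \<cdot> g\<close> modulo the old powers. The hypothesis \<open>top\<close> says
  that the basis vectors in homological degree \<open>r\<close> have too small a degree for such an element to
  exist once all variables are used.\<close>

lemma socle_degree_bound:
  fixes D :: "nat \<Rightarrow> ('r::finite, 'k::field) mpol mat"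
  assumes D: "\<And>p. hmat (B p) (B (Suc p)) 0 (D p)"
    and DD: "\<And>p. D p * D (Suc p) = 0\<^sub>m (length (B p)) (length (B (Suc (Suc p))))"
    and s: "\<And>k p. hmat (B (Suc p)) (B p) (int (a k)) (s k p)"
    and s_0: "\<And>k. D 0 * s k 0 = vpow k (a k) \<cdot>\<^sub>m 1\<^sub>m (length (B 0))"
    and s_Suc: "\<And>k p. D (Suc p) * s k (Suc p) + s k p * D p = vpow k (a k) \<cdot>\<^sub>m 1\<^sub>m (length (B (Suc p)))"
    and w: "w \<in> carrier_vec (length (B 0))" "hvcomp (B 0) d w = w"
    and top: "\<And>b. b \<in> set (B ((card (UNIV :: 'r set)))) \<Longrightarrow> b < d + int (card (UNIV :: 'r set))"
  shows "w \<in> mat_range (D 0)"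
proof (rule ccontr)
  assume w_notin: "w \<notin> mat_range (D 0)"
  let ?l = "\<lambda>p. length (B p)"
  let ?R = "\<lambda>p A. vec_in (?l p) (power_ideal a A)"
  note C = hmat_carrier[OF D] and Cs = hmat_carrier[OF s]
  have DD_vec: "D p *\<^sub>v (D (Suc p) *\<^sub>v v) = 0\<^sub>v (?l p)" if "v \<in> carrier_vec (?l (Suc (Suc p)))" for p v
  proof -
    have "D p *\<^sub>v (D (Suc p) *\<^sub>v v) = 0\<^sub>m (?l p) (?l (Suc (Suc p))) *\<^sub>v v"
      using assoc_mult_mat_vec[OF C C that] DD[of p] by simp
    also have "\<dots> = 0\<^sub>v (?l p)" using that by (intro eq_vecI) auto
    finally show ?thesis .
  qed
  have s_0_vec: "D 0 *\<^sub>v (s k 0 *\<^sub>v v) = vpow k (a k) \<cdot>\<^sub>v v" if "v \<in> carrier_vec (?l 0)" for k v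
    using assoc_mult_mat_vec[OF C Cs that, of k] that by (simp add: s_0 scalar_mat_mult_vec)
  have s_Suc_vec: "D (Suc p) *\<^sub>v (s k (Suc p) *\<^sub>v v) = vpow k (a k) \<cdot>\<^sub>v v - s k p *\<^sub>v (D p *\<^sub>v v)"
    if v: "v \<in> carrier_vec (?l (Suc p))" for k p v
  proof -
    let ?X = "D (Suc p) * s k (Suc p)" and ?Y = "s k p * D p"
    have XY: "?X \<in> carrier_mat (?l (Suc p)) (?l (Suc p))" "?Y \<in> carrier_mat (?l (Suc p)) (?l (Suc p))"
      using C[of "Suc p"] C[of p] Cs[of k "Suc p"] Cs[of k p] by auto
    have "?X *\<^sub>v v + ?Y *\<^sub>v v = vpow k (a k) \<cdot>\<^sub>v v"
      using add_mult_distrib_mat_vec[OF XY v] v by (simp add: s_Suc scalar_mat_mult_vec)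
    then have "?X *\<^sub>v v = vpow k (a k) \<cdot>\<^sub>v v - ?Y *\<^sub>v v"
      using XY v by (auto simp: vec_eq_iff algebra_simps)
    then show ?thesis
      using assoc_mult_mat_vec[OF C Cs v] assoc_mult_mat_vec[OF Cs C v] by simp
  qed
  have "\<exists>g. g \<in> carrier_vec (?l (card A)) \<and> hvcomp (B (card A)) (d + (\<Sum>k\<in>A. int (a k))) g = g \<and>
      (\<forall>p. card A = Suc p \<longrightarrow> D p *\<^sub>v g \<in> ?R p A) \<and>
      (\<forall>u \<in> carrier_vec (?l (Suc (card A))). g - D (card A) *\<^sub>v u \<notin> ?R (card A) A)"
    if "finite A" for A :: "'r set"
    using that
  proof (induction A rule: finite_induct)
    case empty
    have "w - D 0 *\<^sub>v u \<notin> ?R 0 {}" if u: "u \<in> carrier_vec (?l (Suc 0))" for u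
    proof
      assume "w - D 0 *\<^sub>v u \<in> ?R 0 {}"
      then have "w = D 0 *\<^sub>v u" using w(1) C[of 0] by (auto simp: vec_in_empty vec_eq_iff)
      with mat_rangeI[OF C u] w_notin show False by simp
    qed
    with w show ?case by (intro exI[of _ w]) simp
  next
    case (insert k A)
    let ?p = "card A" and ?y = "vpow k (a k)"
    let ?R' = "\<lambda>p. ?R p (insert k A)"
    from insert.IH obtain g where g: "g \<in> carrier_vec (?l ?p)"
        "hvcomp (B ?p) (d + (\<Sum>k\<in>A. int (a k))) g = g"
      and cycle: "\<And>p. ?p = Suc p \<Longrightarrow> D p *\<^sub>v g \<in> ?R p A"
      and notin: "\<And>u. u \<in> carrier_vec (?l (Suc ?p)) \<Longrightarrow> g - D ?p *\<^sub>v u \<notin> ?R ?p A"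
      by auto
    \<comment> \<open>The homotopy maps \<open>g\<close> to an element with boundary \<open>?y \<cdot> g\<close>, up to the image of the boundary
        of \<open>g\<close>, which is zero modulo the old powers.\<close>
    let ?g = "s k ?p *\<^sub>v g"
    have g': "?g \<in> carrier_vec (?l (Suc ?p))" using Cs g(1) by (rule mult_mat_vec_carrier)
    obtain q where q: "D ?p *\<^sub>v ?g = ?y \<cdot>\<^sub>v g - q" "q \<in> ?R ?p A"
    proof (cases ?p)
      case 0
      show ?thesis
      proof (rule that[of "0\<^sub>v (?l 0)"])
        show "D ?p *\<^sub>v ?g = ?y \<cdot>\<^sub>v g - 0\<^sub>v (?l 0)" using s_0_vec[of g k] g(1) 0 by simp
        show "0\<^sub>v (?l 0) \<in> ?R ?p A" using submoduleD(2)[OF submodule_vec_in] 0 by simp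
      qed
    next
      case (Suc p)
      show ?thesis
      proof (rule that[of "s k p *\<^sub>v (D p *\<^sub>v g)"])
        show "D ?p *\<^sub>v ?g = ?y \<cdot>\<^sub>v g - s k p *\<^sub>v (D p *\<^sub>v g)" using s_Suc_vec[of g p k] g(1) Suc by simp
        show "s k p *\<^sub>v (D p *\<^sub>v g) \<in> ?R ?p A" using mult_mat_vec_in[OF Cs cycle[OF Suc]] Suc by simp
      qed
    qed
    have sub: "?R p A \<subseteq> ?R' p" for p by (rule vec_in_mono) auto
    have yR: "?y \<cdot>\<^sub>v v \<in> ?R' p" if "v \<in> carrier_vec (?l p)" for v p
      using that by (intro vpow_smult_in) auto
    have qC: "q \<in> carrier_vec (?l ?p)" using q(2) by (simp add: vec_in_def)
    have "D ?p *\<^sub>v ?g \<in> ?R' ?p"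
      unfolding q(1) using yR[OF g(1)] q(2) sub by (intro submodule_diff[OF submodule_vec_in]) auto
    moreover have "hvcomp (B (Suc ?p)) (d + (\<Sum>k\<in>insert k A. int (a k))) ?g = ?g"
      using hvcomp_mult_mat_vec[OF s g(1), of "d + (\<Sum>k\<in>insert k A. int (a k))" k] insert.hyps g(2)
      by simp
    moreover have "?g - D (Suc ?p) *\<^sub>v u \<notin> ?R' (Suc ?p)" if u: "u \<in> carrier_vec (?l (Suc (Suc ?p)))" for u
    proof
      assume "?g - D (Suc ?p) *\<^sub>v u \<in> ?R' (Suc ?p)"
      then obtain h r where hr: "?g - D (Suc ?p) *\<^sub>v u = ?y \<cdot>\<^sub>v h + r" "h \<in> carrier_vec (?l (Suc ?p))"
          "r \<in> ?R (Suc ?p) A"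
        by (rule vec_in_insertE)
      have rC: "r \<in> carrier_vec (?l (Suc ?p))" using hr(3) by (simp add: vec_in_def)
      have Du: "D (Suc ?p) *\<^sub>v u \<in> carrier_vec (?l (Suc ?p))" using C u by (rule mult_mat_vec_carrier)
      have "D ?p *\<^sub>v ?g = D ?p *\<^sub>v (?g - D (Suc ?p) *\<^sub>v u)"
        using DD_vec[OF u] g' Du C[of ?p]
        by (subst mult_minus_distrib_mat_vec[OF C g' Du]) auto
      also have "\<dots> = ?y \<cdot>\<^sub>v (D ?p *\<^sub>v h) + D ?p *\<^sub>v r"
        unfolding hr(1) using hr(2) rC
        by (simp add: mult_add_distrib_mat_vec[OF C] mult_mat_smult_vec[OF C])
      finally have "?y \<cdot>\<^sub>v g - q = ?y \<cdot>\<^sub>v (D ?p *\<^sub>v h) + D ?p *\<^sub>v r" using q(1) by simp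
      moreover have Dh: "D ?p *\<^sub>v h \<in> carrier_vec (?l ?p)" "D ?p *\<^sub>v r \<in> carrier_vec (?l ?p)"
        using C hr(2) rC by (auto intro: mult_mat_vec_carrier)
      ultimately have "?y \<cdot>\<^sub>v (g - D ?p *\<^sub>v h) = q + D ?p *\<^sub>v r"
        using g(1) qC by (auto simp: vec_eq_iff algebra_simps simp del: index_mult_mat_vec)
      moreover have "q + D ?p *\<^sub>v r \<in> ?R ?p A"
        using q(2) mult_mat_vec_in[OF C hr(3)] by (intro submoduleD(3)[OF submodule_vec_in]) auto
      ultimately have "g - D ?p *\<^sub>v h \<in> ?R ?p A"
        using insert.hyps(2) by (metis vec_in_cancel)
      with notin[OF hr(2)] show False ..
    qed
    ultimately show ?case using insert.hyps g' by (intro exI[of _ ?g]) auto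
  qed
  from this[of UNIV] obtain g where g: "g \<in> carrier_vec (?l (card (UNIV :: 'r set)))"
      "hvcomp (B (card (UNIV :: 'r set))) (d + (\<Sum>k\<in>UNIV. int (a k))) g = g"
    and notin: "\<And>u. u \<in> carrier_vec (?l (Suc (card (UNIV :: 'r set)))) \<Longrightarrow> g - D (card (UNIV :: 'r set)) *\<^sub>v u \<notin> ?R (card (UNIV :: 'r set)) UNIV"
    by auto
  have "g $ i \<in> power_ideal a UNIV" if i: "i < ?l (card (UNIV :: 'r set))" for i
  proof (rule high_degree_in_power_ideal)
    show "homogeneous total_degree (d + (\<Sum>k\<in>UNIV. int (a k)) - B (card (UNIV :: 'r set)) ! i) (g $ i)"
      using arg_cong[OF g(2), of "\<lambda>v. v $ i"] i by (simp add: homogeneous_iff_hcomp)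
    show "d + (\<Sum>k\<in>UNIV. int (a k)) - B (card (UNIV :: 'r set)) ! i > (\<Sum>j\<in>UNIV. int (a j) - 1)"
      using top[of "B (card (UNIV :: 'r set)) ! i"] i by (simp add: sum_subtractf)
  qed
  then have "g \<in> ?R (card (UNIV :: 'r set)) UNIV" using g(1) by (simp add: vec_in_def)
  moreover have "g - D (card (UNIV :: 'r set)) *\<^sub>v 0\<^sub>v (?l (Suc (card (UNIV :: 'r set)))) = g" using g(1) C[of "(card (UNIV :: 'r set))"] by auto
  ultimately show False using notin[of "0\<^sub>v (?l (Suc (card (UNIV :: 'r set))))"] by simp
qed

section \<open>Submodules generated in bounded degrees\<close>

text \<open>The product of a submodule \<open>Z\<close> with the ideal generated by the variables \<open>y\<^sub>k\<close>, \<open>k \<in> A\<close>. It is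
  in general smaller than the intersection of \<open>Z\<close> with \<open>vars_vec A n\<close>, which is the product of the whole free
  module with that ideal.\<close>

inductive_set var_multiples ::
    "'r set \<Rightarrow> nat \<Rightarrow> ('r::finite, 'k::comm_ring_1) mpol vec set \<Rightarrow> ('r, 'k) mpol vec set"
  for A n Z where
    zero: "0\<^sub>v n \<in> var_multiples A n Z"
  | add: "w \<in> var_multiples A n Z \<Longrightarrow> u \<in> Z \<Longrightarrow> k \<in> A \<Longrightarrow> w + vpow k 1 \<cdot>\<^sub>v u \<in> var_multiples A n Z"

abbreviation vars_vec :: "'r set \<Rightarrow> nat \<Rightarrow> ('r::finite, 'k::comm_ring_1) mpol vec set" where
  "vars_vec A n \<equiv> vec_in n (power_ideal (\<lambda>_. 1) A)"

lemma var_multiples_mono: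
  assumes "A \<subseteq> A'" "z \<in> var_multiples A n Z" shows "z \<in> var_multiples A' n Z"
  using assms(2) by induction (use assms(1) in \<open>auto intro: var_multiples.intros simp del: One_nat_def\<close>)

text \<open>Lift the coefficients of a combination of elements of the range one by one.\<close>

lemma var_multiples_range_lift:
  assumes M: "M \<in> carrier_mat nr nc" and w: "w \<in> var_multiples A nr (mat_range M)"
  shows "\<exists>r \<in> vars_vec A nc. M *\<^sub>v r = w"
  using w
proof induction
  case zero
  have "M *\<^sub>v 0\<^sub>v nc = 0\<^sub>v nr" using M by auto
  then show ?case using submoduleD(2)[OF submodule_vec_in] by blast
next
  case (add w u k)
  then obtain r where r: "r \<in> vars_vec A nc" "M *\<^sub>v r = w" by auto
  obtain x where x: "x \<in> carrier_vec nc" "u = M *\<^sub>v x" using mat_rangeE[OF add(2) M] by metis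
  have "r + vpow k 1 \<cdot>\<^sub>v x \<in> vars_vec A nc"
    using r(1) vpow_smult_in[of k A x nc "\<lambda>_. 1"] add(3) x(1) by (intro submoduleD(3)[OF submodule_vec_in]) auto
  moreover have "M *\<^sub>v (r + vpow k 1 \<cdot>\<^sub>v x) = w + vpow k 1 \<cdot>\<^sub>v u"
    using r x M by (simp add: vec_in_def mult_add_distrib_mat_vec[OF M] mult_mat_smult_vec[OF M])
  ultimately show ?case by blast
qed

text \<open>If \<open>F\<close> is the free module that contains \<open>Z\<close> and \<open>Q\<^sub>A\<close> is the ideal generated by the variables
  in \<open>A\<close>, then \<open>Tor\<^sub>1(F/Z, T/Q\<^sub>A)\<close> is \<open>(Z \<inter> Q\<^sub>A F) / Q\<^sub>A Z\<close>. The condition is that this module vanishes in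
  degrees larger than \<open>m\<close>, for all \<open>A\<close>. For \<open>A = UNIV\<close> it bounds the degrees of minimal generators; the
  other sets are there for the induction.\<close>

definition tor_bounded ::
    "int \<Rightarrow> int list \<Rightarrow> ('r::finite, 'k::comm_ring_1) mpol vec set \<Rightarrow> bool" where
  "tor_bounded m cs Z \<longleftrightarrow> (\<forall>A z e. z \<in> Z \<longrightarrow> hvcomp cs e z = z \<longrightarrow> m < e \<longrightarrow>
    z \<in> vars_vec A (length cs) \<longrightarrow> z \<in> var_multiples A (length cs) Z)"

text \<open>Induction over \<open>A\<close>. If \<open>z\<close> in \<open>Z\<close> is \<open>y\<^sub>k h + r\<close> with \<open>r\<close> in \<open>Q\<^sub>A F\<close>, the hypothesis corrects \<open>h\<close> by an
  element of \<open>Q\<^sub>A F\<close> to an element \<open>u\<close> of \<open>Z\<close>; then \<open>z - y\<^sub>k u\<close> lies in \<open>Z \<inter> Q\<^sub>A F\<close>, to which the induction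
  hypothesis applies. This is the exact sequence for Tor that comes from multiplication by \<open>y\<^sub>k\<close> on
  \<open>T/Q\<^sub>A\<close>.\<close>

lemma tor_boundedI:
  fixes Z :: "('r::finite, 'k::field) mpol vec set"
  assumes Z: "graded_submodule cs Z"
    and H: "\<And>A k h r e. \<lbrakk>k \<notin> A; h \<in> carrier_vec (length cs); hvcomp cs e h = h; m \<le> e;
        r \<in> vars_vec A (length cs); vpow k 1 \<cdot>\<^sub>v h + r \<in> Z\<rbrakk> \<Longrightarrow>
      \<exists>r' \<in> vars_vec A (length cs). hvcomp cs e r' = r' \<and> h - r' \<in> Z"
  shows "tor_bounded m cs Z"
  unfolding tor_bounded_def
proof (intro allI impI)
  let ?n = "length cs"
  have sub: "vec_submodule ?n Z" using Z by (simp add: graded_submodule_def)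
  fix A :: "'r set" and z e
  assume z: "z \<in> Z" "hvcomp cs e z = z" and e: "m < e" and zA: "z \<in> vars_vec A ?n"
  have "finite A" by simp
  then show "z \<in> var_multiples A ?n Z"
    using z zA
  proof (induction A arbitrary: z rule: finite_induct)
    case empty
    then have "z = 0\<^sub>v ?n" by (simp add: vec_in_empty)
    then show ?case by (simp add: var_multiples.zero)
  next
    case (insert k A)
    obtain h r where hr: "z = vpow k 1 \<cdot>\<^sub>v h + r" "h \<in> carrier_vec ?n" "r \<in> vars_vec A ?n"
      by (rule vec_in_insertE[OF insert.prems(3)])
    let ?h = "hvcomp cs (e - 1) h" and ?r = "hvcomp cs e r"
    have rC: "r \<in> carrier_vec ?n" using hr(3) by (simp add: vec_in_def)
    have "hvcomp cs e z = vpow k 1 \<cdot>\<^sub>v ?h + ?r"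
      using hvcomp_smult[OF homogeneous_vpow[of 1 k] hr(2), of e] hr(2) rC
      unfolding hr(1) by (subst hvcomp_add) auto
    then have z: "z = vpow k 1 \<cdot>\<^sub>v ?h + ?r" using insert.prems(2) by simp
    have rA: "?r \<in> vars_vec A ?n" by (rule vec_in_hvcomp[OF hr(3)])
    obtain r' where r': "r' \<in> vars_vec A ?n" "hvcomp cs (e - 1) r' = r'" "?h - r' \<in> Z"
      using H[OF insert.hyps(2) hvcomp_carrier, of "e - 1" "e - 1" h ?r] rA insert.prems(1) z e by auto
    have r'C: "r' \<in> carrier_vec ?n" using r'(1) by (simp add: vec_in_def)
    \<comment> \<open>\<open>?q\<close> is what remains of \<open>z\<close> after \<open>vpow k 1 \<cdot>\<^sub>v ?u\<close> has been subtracted.\<close>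
    let ?u = "?h - r'" and ?q = "?r + vpow k 1 \<cdot>\<^sub>v r'"
    have q: "?q = z - vpow k 1 \<cdot>\<^sub>v ?u"
      by (subst z) (use r'C in \<open>auto simp: vec_eq_iff algebra_simps\<close>)
    have "?q \<in> Z" unfolding q
      by (rule submodule_diff[OF sub insert.prems(1) submoduleD(4)[OF sub r'(3)]])
    moreover have "hvcomp cs e ?q = ?q"
      using hvcomp_smult[OF homogeneous_vpow[of 1 k] r'C, of e] r'(2) r'C
      by (subst hvcomp_add) auto
    moreover have "?q \<in> vars_vec A ?n"
      using rA r'(1) by (intro submoduleD(3,4)[OF submodule_vec_in])
    ultimately have "?q \<in> var_multiples A ?n Z" by (rule insert.IH)
    then have "?q \<in> var_multiples (insert k A) ?n Z" by (rule var_multiples_mono[rotated]) auto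
    from var_multiples.add[OF this r'(3), of k]
    have "?q + vpow k 1 \<cdot>\<^sub>v ?u \<in> var_multiples (insert k A) ?n Z" by simp
    moreover have "?q + vpow k 1 \<cdot>\<^sub>v ?u = z"
      unfolding q using submoduleD(1)[OF sub insert.prems(1)] r'C by (intro eq_vecI) auto
    ultimately show ?case by simp
  qed
qed

text \<open>Passing to the next syzygy module costs one degree: if \<open>y\<^sub>k h + r\<close> is a syzygy with \<open>r\<close> in \<open>Q\<^sub>A F\<close>, then
  \<open>M h\<close> lies in \<open>Q\<^sub>A\<close> times the target, because \<open>y\<^sub>k\<close> is a nonzerodivisor modulo \<open>Q\<^sub>A\<close>. The
  condition on the range of \<open>M\<close> then gives \<open>M h = M s\<close> with \<open>s\<close> in \<open>Q\<^sub>A F\<close>, and \<open>h - s\<close> is a syzygy.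
  The degree of \<open>h\<close> is one less than the degree of \<open>y\<^sub>k h\<close>.\<close>

lemma tor_bounded_kernel:
  fixes M :: "('r::finite, 'k::field) mpol mat"
  assumes M: "hmat cs bs 0 M" and Z: "tor_bounded m cs (mat_range M)"
  shows "tor_bounded (m + 1) bs (mat_kernel M)"
proof (rule tor_boundedI[OF graded_submodule_kernel[OF M]])
  note C = hmat_carrier[OF M]
  let ?n = "length cs" and ?l = "length bs"
  fix A :: "'r set" and k h r e
  assume k: "k \<notin> A" and h: "h \<in> carrier_vec ?l" "hvcomp bs e h = h" and e: "m + 1 \<le> e"
    and r: "r \<in> vars_vec A ?l" and ker: "vpow k 1 \<cdot>\<^sub>v h + r \<in> mat_kernel M"
  have rC: "r \<in> carrier_vec ?l" using r by (simp add: vec_in_def)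
  have MC: "M *\<^sub>v h \<in> carrier_vec ?n" "M *\<^sub>v r \<in> carrier_vec ?n" using C h(1) rC by auto
  have "vpow k 1 \<cdot>\<^sub>v (M *\<^sub>v h) + M *\<^sub>v r = 0\<^sub>v ?n"
    using mat_kernelD(2)[OF C ker] h(1) rC
    by (simp add: mult_add_distrib_mat_vec[OF C] mult_mat_smult_vec[OF C])
  then have "vpow k 1 \<cdot>\<^sub>v (M *\<^sub>v h) = (- 1) \<cdot>\<^sub>v (M *\<^sub>v r)"
    using MC by (auto simp: vec_eq_iff eq_neg_iff_add_eq_0 simp del: index_mult_mat_vec)
  also have "\<dots> \<in> vars_vec A ?n" by (intro submoduleD(4)[OF submodule_vec_in] mult_mat_vec_in[OF C r])
  finally have "M *\<^sub>v h \<in> vars_vec A ?n" using k by (metis vec_in_cancel)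
  moreover have "hvcomp cs e (M *\<^sub>v h) = M *\<^sub>v h" using hvcomp_mult_mat_vec[OF M h(1), of e] h(2) by simp
  moreover have "M *\<^sub>v h \<in> mat_range M" by (rule mat_rangeI[OF C h(1)])
  ultimately have "M *\<^sub>v h \<in> var_multiples A ?n (mat_range M)"
    using Z[unfolded tor_bounded_def, rule_format, of "M *\<^sub>v h" e A] e by simp
  then obtain s where s: "s \<in> vars_vec A ?l" "M *\<^sub>v s = M *\<^sub>v h"
    using var_multiples_range_lift[OF C] by blast
  have sC: "s \<in> carrier_vec ?l" using s(1) by (simp add: vec_in_def)
  have "M *\<^sub>v hvcomp bs e s = M *\<^sub>v h"
    using hvcomp_mult_mat_vec[OF M sC, of e] hvcomp_mult_mat_vec[OF M h(1), of e] s(2) h(2) by simp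
  then have "h - hvcomp bs e s \<in> mat_kernel M"
    using h(1) MC by (intro mat_kernelI[OF C]) (auto simp: mult_minus_distrib_mat_vec[OF C] simp del: index_mult_mat_vec)
  moreover have "hvcomp bs e s \<in> vars_vec A ?l" by (rule vec_in_hvcomp[OF s(1)])
  ultimately show "\<exists>r' \<in> vars_vec A ?l. hvcomp bs e r' = r' \<and> h - r' \<in> mat_kernel M" by force
qed

text \<open>Induction over the degree. In degrees above \<open>m\<close> no entry of a vector in \<open>Z\<close> has a constant
  term, so the condition on Tor for the set of all variables shows that the vector is a combination of
  elements of \<open>Z\<close> of smaller degree with variables as coefficients.\<close>

lemma generated_up_to_degree:
  fixes Z :: "('r::finite, 'k::field) mpol vec set"
  assumes Z: "graded_submodule cs Z" "tor_bounded m cs Z" and cs: "\<And>c. c \<in> set cs \<Longrightarrow> c \<le> m"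
    and W: "vec_submodule (length cs) W"
    and low: "\<And>z e. z \<in> Z \<Longrightarrow> hvcomp cs e z = z \<Longrightarrow> e \<le> m \<Longrightarrow> z \<in> W"
  shows "Z \<subseteq> W"
proof
  let ?n = "length cs"
  have sub: "vec_submodule ?n Z" using Z(1) by (simp add: graded_submodule_def)
  have *: "\<forall>z\<in>Z. hvcomp cs e z = z \<longrightarrow> z \<in> W" if "m \<le> e" for e
    using that
  proof (induction e rule: int_ge_induct)
    case base
    then show ?case using low by blast
  next
    case (step e)
    show ?case
    proof (intro ballI impI)
      fix z assume z: "z \<in> Z" "hvcomp cs (e + 1) z = z"
      have "z $ i \<in> power_ideal (\<lambda>_. 1) UNIV" if i: "i < ?n" for i
      proof (rule high_degree_in_power_ideal)
        show "homogeneous total_degree (e + 1 - cs ! i) (z $ i)"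
          using arg_cong[OF z(2), of "\<lambda>v. v $ i"] i by (simp add: homogeneous_iff_hcomp)
        show "e + 1 - cs ! i > (\<Sum>j\<in>UNIV. int 1 - 1)" using cs[of "cs ! i"] i step.hyps by simp
      qed
      then have "z \<in> vars_vec UNIV ?n" using submoduleD(1)[OF sub z(1)] by (simp add: vec_in_def)
      with Z(2) z step.hyps have "z \<in> var_multiples UNIV ?n Z" unfolding tor_bounded_def by fastforce
      then have "z \<in> carrier_vec ?n \<and> hvcomp cs (e + 1) z \<in> W"
      proof induction
        case zero
        then show ?case using submoduleD(2)[OF W] by simp
      next
        case (add w u k)
        have u: "u \<in> carrier_vec ?n" by (rule submoduleD(1)[OF sub add(2)])
        have "hvcomp cs e u \<in> W" using step.IH add(2) Z(1) by (auto simp: graded_submodule_def)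
        moreover have "hvcomp cs (e + 1) (w + vpow k 1 \<cdot>\<^sub>v u) =
            hvcomp cs (e + 1) w + vpow k 1 \<cdot>\<^sub>v hvcomp cs e u"
          using add.IH u hvcomp_smult[OF homogeneous_vpow[of 1 k] u, of "e + 1"] by (subst hvcomp_add) auto
        ultimately show ?case using add.IH u submoduleD(3,4)[OF W] by simp
      qed
      with z(2) show "z \<in> W" by simp
    qed
  qed
  fix z assume z: "z \<in> Z"
  have "hvcomp cs e z \<in> W" for e
    using *[of e] low[of "hvcomp cs e z" e] z Z(1) by (cases "m \<le> e") (auto simp: graded_submodule_def)
  then show "z \<in> W" using in_submodule_if_components[OF W submoduleD(1)[OF sub z]] by blast
qed

section \<open>Minimal generators\<close>

lemma finite_total_degree: "finite {t :: 'r::finite \<Rightarrow>\<^sub>0 nat. total_degree t = d}" (is "finite ?T")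
proof (rule finite_imageD)
  have "Poly_Mapping.lookup t x \<le> nat d" if "total_degree t = d" for x and t :: "'r \<Rightarrow>\<^sub>0 nat"
  proof -
    have "int (Poly_Mapping.lookup t x) \<le> total_degree t"
      unfolding total_degree_def by (rule member_le_sum) auto
    with that show ?thesis by simp
  qed
  then have "Poly_Mapping.lookup ` ?T \<subseteq> {f. \<forall>x. (x \<in> UNIV \<longrightarrow> f x \<in> {..nat d}) \<and> (x \<notin> UNIV \<longrightarrow> f x = 0)}"
    by auto
  then show "finite (Poly_Mapping.lookup ` ?T)" by (rule finite_subset) (intro finite_set_of_finite_funs; simp)
  show "inj_on Poly_Mapping.lookup ?T" by (simp add: inj_on_def)
qed

text \<open>Gaussian elimination, one position of \<open>P\<close> at a time: the vectors of \<open>V\<close> with coefficient zero at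
  that position form a subspace, which together with one vector outside it spans \<open>V\<close>.\<close>

lemma finite_spanning_set:
  fixes V :: "('r, 'k::field) mpol vec set"
  assumes "finite P" "V \<subseteq> carrier_vec n"
    and "\<And>v w a. v \<in> V \<Longrightarrow> w \<in> V \<Longrightarrow> v - Const a \<cdot>\<^sub>v w \<in> V"
    and "\<And>v. v \<in> V \<Longrightarrow> \<forall>(i, t)\<in>P. Poly_Mapping.lookup (v $ i) t = 0 \<Longrightarrow> v = 0\<^sub>v n"
    and "fst ` P \<subseteq> {..<n}"
  shows "\<exists>B. finite B \<and> B \<subseteq> V \<and> (\<forall>W. vec_submodule n W \<longrightarrow> B \<subseteq> W \<longrightarrow> V \<subseteq> W)"
  using assms
proof (induction P arbitrary: V rule: finite_induct)
  case empty
  then have "V \<subseteq> {0\<^sub>v n}" by auto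
  then show ?case by (intro exI[of _ "{}"]) (auto dest: submoduleD(2))
next
  case (insert p P)
  obtain i t where p: "p = (i, t)" by (cases p)
  have i: "i < n" using insert.prems(4) p by auto
  let ?c = "\<lambda>v. Poly_Mapping.lookup (v $ i) t"
  let ?V = "{v\<in>V. ?c v = 0}"
  have c: "?c (v - Const a \<cdot>\<^sub>v w) = ?c v - a * ?c w" if "v \<in> V" "w \<in> V" for v w a
  proof -
    have "v \<in> carrier_vec n" "w \<in> carrier_vec n" using that insert.prems(1) by auto
    then show ?thesis using i
      by (simp add: lookup_minus Const_def mult_map_scale_conv_mult[symmetric] map.rep_eq when_def)
  qed
  have "\<exists>B. finite B \<and> B \<subseteq> ?V \<and> (\<forall>W. vec_submodule n W \<longrightarrow> B \<subseteq> W \<longrightarrow> ?V \<subseteq> W)"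
  proof (rule insert.IH)
    show "v - Const a \<cdot>\<^sub>v w \<in> ?V" if "v \<in> ?V" "w \<in> ?V" for v w a
      using that c[of v w a] insert.prems(2)[of v w a] by simp
    show "v = 0\<^sub>v n" if "v \<in> ?V" "\<forall>(i, t)\<in>P. Poly_Mapping.lookup (v $ i) t = 0" for v
      using that insert.prems(3)[of v] by (simp add: p)
  qed (use insert.prems in auto)
  then obtain B where B: "finite B" "B \<subseteq> ?V" "\<And>W. vec_submodule n W \<Longrightarrow> B \<subseteq> W \<Longrightarrow> ?V \<subseteq> W" by blast
  show ?case
  proof (cases "V = ?V")
    case True
    show ?thesis by (rule exI[of _ B]) (use B True in auto)
  next
    case False
    then obtain w where w: "w \<in> V" "?c w \<noteq> 0" by blast
    have "V \<subseteq> W" if W: "vec_submodule n W" and "insert w B \<subseteq> W" for W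
    proof
      fix v assume v: "v \<in> V"
      let ?a = "?c v / ?c w"
      have "v - Const ?a \<cdot>\<^sub>v w \<in> ?V" using c[OF v w(1), of ?a] insert.prems(2)[OF v w(1)] w(2) by simp
      then have "v - Const ?a \<cdot>\<^sub>v w \<in> W" using B(3)[OF W] that(2) by auto
      then have "(v - Const ?a \<cdot>\<^sub>v w) + Const ?a \<cdot>\<^sub>v w \<in> W"
        using that(2) by (intro submoduleD(3,4)[OF W]) auto
      moreover have "(v - Const ?a \<cdot>\<^sub>v w) + Const ?a \<cdot>\<^sub>v w = v"
        using subsetD[OF insert.prems(1) v] subsetD[OF insert.prems(1) w(1)] by (intro eq_vecI) auto
      ultimately show "v \<in> W" by simp
    qed
    then show ?thesis using B w(1) by (intro exI[of _ "insert w B"]) auto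
  qed
qed

text \<open>Only finitely many degrees matter: above \<open>m\<close> nothing new is needed, and below the smallest
  degree of a basis vector there are no nonzero elements. Each degree contributes a vector space of finite dimension.\<close>

lemma finite_homogeneous_generators:
  fixes Z :: "('r::finite, 'k::field) mpol vec set"
  assumes Z: "graded_submodule cs Z" "tor_bounded m cs Z" and cs: "\<And>c. c \<in> set cs \<Longrightarrow> c \<le> m"
  obtains G where "finite G" "G \<subseteq> Z" "\<And>g. g \<in> G \<Longrightarrow> \<exists>e\<le>m. hvcomp cs e g = g"
    "\<And>W. vec_submodule (length cs) W \<Longrightarrow> G \<subseteq> W \<Longrightarrow> Z \<subseteq> W"
proof -
  let ?n = "length cs"
  have sub: "vec_submodule ?n Z" using Z(1) by (simp add: graded_submodule_def)
  let ?V = "\<lambda>e. {z\<in>Z. hvcomp cs e z = z}"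
  have "\<exists>B. finite B \<and> B \<subseteq> ?V e \<and> (\<forall>W. vec_submodule ?n W \<longrightarrow> B \<subseteq> W \<longrightarrow> ?V e \<subseteq> W)" for e
  proof (rule finite_spanning_set)
    \<comment> \<open>A homogeneous vector of degree \<open>e\<close> has coefficients at these positions only.\<close>
    let ?P = "\<Union>i<?n. Pair i ` {t. total_degree t = e - cs ! i}"
    show "finite ?P" by (intro finite_UN_I finite_imageI finite_total_degree) simp
    show "fst ` ?P \<subseteq> {..<?n}" by auto
    show "?V e \<subseteq> carrier_vec ?n" using submoduleD(1)[OF sub] by auto
    show "v - Const a \<cdot>\<^sub>v w \<in> ?V e" if "v \<in> ?V e" "w \<in> ?V e" for v w a
    proof -
      have C: "v \<in> carrier_vec ?n" "w \<in> carrier_vec ?n" using that submoduleD(1)[OF sub] by auto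
      have "homogeneous total_degree 0 (Const a :: ('r, 'k) mpol)"
        by (simp add: homogeneous_def Const_def)
      from hvcomp_smult[OF this C(2), of e] have "hvcomp cs e (v - Const a \<cdot>\<^sub>v w) = v - Const a \<cdot>\<^sub>v w"
        using C that by (subst hvcomp_diff) auto
      with that show ?thesis by (auto intro: submodule_diff[OF sub] submoduleD(4)[OF sub])
    qed
    show "v = 0\<^sub>v ?n" if v: "v \<in> ?V e" and 0: "\<forall>(i, t)\<in>?P. Poly_Mapping.lookup (v $ i) t = 0" for v
    proof (rule eq_vecI)
      show "dim_vec v = dim_vec (0\<^sub>v ?n)" using v submoduleD(1)[OF sub] by auto
      fix i assume "i < dim_vec (0\<^sub>v ?n)"
      then have i: "i < ?n" by simp
      have "Poly_Mapping.lookup (v $ i) t = 0" for t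
      proof (cases "total_degree t = e - cs ! i")
        case True
        with i 0 show ?thesis by fastforce
      next
        case False
        moreover have "hvcomp cs e v $ i = v $ i" using v by simp
        then have "hcomp (e - cs ! i) (v $ i) = v $ i" unfolding hvcomp_index[OF i] .
        ultimately show ?thesis using lookup_hcomp[of "e - cs ! i" "v $ i" t] by simp
      qed
      then show "v $ i = 0\<^sub>v ?n $ i" using i by (auto intro: poly_mapping_eqI)
    qed
  qed
  then obtain B where
    "\<forall>e. finite (B e) \<and> B e \<subseteq> ?V e \<and> (\<forall>W. vec_submodule ?n W \<longrightarrow> B e \<subseteq> W \<longrightarrow> ?V e \<subseteq> W)"
    by (rule choice[OF allI, THEN exE])
  then have B: "\<And>e. finite (B e)" "\<And>e. B e \<subseteq> ?V e"
      "\<And>e W. vec_submodule ?n W \<Longrightarrow> B e \<subseteq> W \<Longrightarrow> ?V e \<subseteq> W"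
    by blast+
  obtain lo where lo: "\<And>c. c \<in> set cs \<Longrightarrow> lo \<le> c"
    using bdd_below_finite[of "set cs"] by (auto simp: bdd_below_def)
  let ?G = "\<Union>e\<in>{lo..m}. B e"
  show ?thesis
  proof (rule that[of ?G])
    show "finite ?G" using B(1) by simp
    show "?G \<subseteq> Z" using B(2) by blast
    show "\<exists>e\<le>m. hvcomp cs e g = g" if "g \<in> ?G" for g using that B(2) by fastforce
    show "Z \<subseteq> W" if W: "vec_submodule ?n W" and G: "?G \<subseteq> W" for W
    proof (rule generated_up_to_degree[OF Z cs W])
      fix z e assume z: "z \<in> Z" "hvcomp cs e z = z" "e \<le> m"
      show "z \<in> W"
      proof (cases "lo \<le> e")
        case True
        then have "B e \<subseteq> W" using G z(3) by (meson SUP_le_iff atLeastAtMost_iff)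
        from B(3)[OF W this] z show ?thesis by auto
      next
        case False
        have "e - cs ! i < 0" if "i < ?n" for i using lo[of "cs ! i"] that False by simp
        then have "hvcomp cs e z = 0\<^sub>v ?n" by (intro eq_vecI) (auto simp: hcomp_neg)
        with z submoduleD(2)[OF W] show ?thesis by simp
      qed
    qed
  qed
qed

lemma mult_mat_vec_delete_col:
  assumes M: "M \<in> carrier_mat nr (Suc nc)" and u: "u \<in> carrier_vec (Suc nc)" "u $ j = 0" and j: "j < Suc nc"
  defines "skip \<equiv> \<lambda>l. if l < j then l else Suc l"
  shows "mat nr nc (\<lambda>(i, l). M $$ (i, skip l)) *\<^sub>v vec nc (\<lambda>l. u $ skip l) = M *\<^sub>v u"
proof (rule eq_vecI)
  let ?M = "mat nr nc (\<lambda>(i, l). M $$ (i, skip l))" and ?u = "vec nc (\<lambda>l. u $ skip l)"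
  fix i assume "i < dim_vec (M *\<^sub>v u)"
  then have i: "i < nr" using M by simp
  have M': "?M \<in> carrier_mat nr nc" by simp
  have bij: "bij_betw skip {..<nc} ({..<Suc nc} - {j})"
    by (rule bij_betwI[of _ _ _ "\<lambda>l. if l < j then l else l - 1"]) (use j in \<open>auto simp: skip_def split: if_splits\<close>)
  have "(M *\<^sub>v u) $ i = (\<Sum>l\<in>{..<Suc nc} - {j}. M $$ (i, l) * u $ l)"
    unfolding mult_mat_vec_index_sum[OF M u(1) i] using u(2) j by (intro sum.mono_neutral_right) auto
  also have "\<dots> = (\<Sum>l<nc. M $$ (i, skip l) * u $ skip l)"
    by (rule sum.reindex_bij_betw[OF bij, symmetric])
  also have "\<dots> = (?M *\<^sub>v ?u) $ i"
    using i by (subst mult_mat_vec_index_sum[OF M']) auto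
  finally show "(?M *\<^sub>v ?u) $ i = (M *\<^sub>v u) $ i" by simp
qed (use M in simp)

text \<open>If a relation between the generators had an entry with a nonzero constant term, its component of
  the degree of that generator would express the generator by the others, and a shorter list would do.
  So minimal length forces minimality of the resolution.\<close>

lemma minimal_homogeneous_generators:
  fixes Z :: "('r::finite, 'k::field) mpol vec set"
  assumes Z: "graded_submodule cs Z" "tor_bounded m cs Z" and cs: "\<And>c. c \<in> set cs \<Longrightarrow> c \<le> m"
  obtains bs M where "hmat cs bs 0 M" "mat_range M = Z" "set bs \<subseteq> {..m}"
    "mat_kernel M \<subseteq> vars_vec UNIV (length bs)"
proof -
  let ?n = "length cs"
  have sub: "vec_submodule ?n Z" using Z(1) by (simp add: graded_submodule_def)
  define gen where "gen = (\<lambda>(bs, M). hmat cs bs 0 M \<and> mat_range M = Z \<and> set bs \<subseteq> {..m})"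
  obtain G where G: "finite G" "G \<subseteq> Z" "\<And>g. g \<in> G \<Longrightarrow> \<exists>e\<le>m. hvcomp cs e g = g"
      "\<And>W. vec_submodule ?n W \<Longrightarrow> G \<subseteq> W \<Longrightarrow> Z \<subseteq> W"
    using finite_homogeneous_generators[OF Z cs] by metis
  obtain gs where gs: "set gs = G" using finite_list[OF G(1)] by blast
  obtain dg where dg: "\<And>g. g \<in> G \<Longrightarrow> dg g \<le> m \<and> hvcomp cs (dg g) g = g" using G(3) by metis
  have "gen (map dg gs, mat_of_cols ?n gs)"
  proof -
    let ?M = "mat_of_cols ?n gs"
    have C: "?M \<in> carrier_mat ?n (length gs)" by simp
    have col: "col ?M j = gs ! j" if "j < length gs" for j
      using that gs G(2) submoduleD(1)[OF sub] nth_mem[OF that] by (intro col_mat_of_cols) auto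
    have g: "gs ! j \<in> G" if "j < length gs" for j using gs that by auto
    have "hmat cs (map dg gs) 0 ?M" using dg[OF g] by (auto simp: hmat_iff_cols col)
    moreover have "mat_range ?M \<subseteq> Z"
      using range_subset_submodule[OF C sub] g G(2) by (auto simp: mat_range_def col)
    moreover have "Z \<subseteq> mat_range ?M"
    proof (rule G(4)[OF submodule_mat_range[OF C]])
      show "G \<subseteq> mat_range ?M" using col_in_mat_range[OF C] by (auto simp: gs[symmetric] in_set_conv_nth col)
    qed
    ultimately show ?thesis using dg gs by (auto simp: gen_def)
  qed
  then obtain x where "gen x" and x_min: "\<And>y. gen y \<Longrightarrow> length (fst x) \<le> length (fst y)"
    using ex_has_least_nat[of gen _ "\<lambda>x. length (fst x)"] by blast
  moreover obtain bs M where x: "x = (bs, M)" by (cases x)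
  ultimately have M: "hmat cs bs 0 M" and range: "mat_range M = Z" and bs: "set bs \<subseteq> {..m}"
    and min: "\<And>bs' M'. gen (bs', M') \<Longrightarrow> length bs \<le> length bs'"
    by (auto simp: gen_def)
  note C = hmat_carrier[OF M]
  have "mat_kernel M \<subseteq> vars_vec UNIV (length bs)"
  proof (rule ccontr)
    assume "\<not> ?thesis"
    then obtain v j where v: "v \<in> mat_kernel M" and j: "j < length bs"
        and "v $ j \<notin> power_ideal (\<lambda>_. 1) UNIV"
      using mat_kernel_carrier[OF C] by (fastforce simp: vec_in_def)
    then obtain t where "t \<in> Poly_Mapping.keys (v $ j)" "\<forall>k. \<not> 1 \<le> Poly_Mapping.lookup t k"
      by (auto simp: power_ideal_def)
    moreover from this(2) have "t = 0" by (intro poly_mapping_eqI) (auto simp: not_le)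
    moreover define a where "a = Poly_Mapping.lookup (v $ j) 0"
    ultimately have a: "a \<noteq> 0" by (simp add: in_keys_iff)
    \<comment> \<open>In this degree the entry at \<open>j\<close> is a nonzero constant.\<close>
    define v' where "v' = hvcomp bs (bs ! j) v"
    have v': "v' \<in> mat_kernel M"
      using graded_submodule_kernel[OF M] v by (simp add: graded_submodule_def v'_def)
    have v'C: "v' \<in> carrier_vec (length bs)" by (simp add: v'_def)
    have v'_j: "v' $ j = Const a" unfolding v'_def Const_def
      using j by (auto intro!: poly_mapping_eqI
        simp: lookup_hcomp lookup_single total_degree_eq_0_iff a_def when_def)
    obtain l where l: "length bs = Suc l" using j by (cases "length bs") auto
    let ?skip = "\<lambda>l. if l < j then l else Suc l"
    let ?bs = "map (\<lambda>l. bs ! ?skip l) [0..<l]" and ?M = "mat ?n l (\<lambda>(i, l). M $$ (i, ?skip l))"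
    have skip: "?skip i < length bs" if "i < l" for i using that l by auto
    have C': "?M \<in> carrier_mat ?n l" by simp
    have col: "col ?M i = col M (?skip i)" if "i < l" for i
      using that C skip[OF that] by (intro eq_vecI) auto
    have "hvcomp cs (0 + ?bs ! i) (col ?M i) = col ?M i" if "i < length ?bs" for i
    proof -
      have "i < l" using that by simp
      then have "?bs ! i = bs ! ?skip i" by simp
      moreover have "hvcomp cs (0 + bs ! ?skip i) (col M (?skip i)) = col M (?skip i)"
        using M skip[OF \<open>i < l\<close>] unfolding hmat_iff_cols by blast
      ultimately show ?thesis using col[OF \<open>i < l\<close>] by metis
    qed
    then have "hmat cs ?bs 0 ?M" by (simp add: hmat_iff_cols)
    moreover have "mat_range ?M \<subseteq> Z"
    proof -
      have "col ?M i \<in> Z" if "i < l" for i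
        using col_in_mat_range[OF C skip[OF that]] unfolding range[symmetric] col[OF that] .
      then show ?thesis using range_subset_submodule[OF C' sub] by (auto simp: mat_range_def)
    qed
    moreover have "z \<in> mat_range ?M" if z: "z \<in> Z" for z
    proof -
      obtain x where x: "x \<in> carrier_vec (length bs)" "z = M *\<^sub>v x" using mat_rangeE[OF _ C] z range by metis
      let ?f = "x $ j * Const (1 / a)"
      define u where "u = x - ?f \<cdot>\<^sub>v v'"
      have uC: "u \<in> carrier_vec (Suc l)" using x(1) v'C l by (simp add: u_def)
      have "Const (1 / a) * Const a = (1 :: ('r, 'k) mpol)" using a by (simp add: Const_def mult_single)
      then have "u $ j = 0" using x(1) v'C j by (simp add: u_def v'_j mult.assoc)
      then have "?M *\<^sub>v vec l (\<lambda>i. u $ ?skip i) = M *\<^sub>v u"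
        using mult_mat_vec_delete_col[of M ?n l u j] C uC j l by simp
      also have "\<dots> = M *\<^sub>v x - ?f \<cdot>\<^sub>v (M *\<^sub>v v')"
        unfolding u_def using x(1) v'C
        by (subst mult_minus_distrib_mat_vec[OF C]) (auto simp: mult_mat_smult_vec[OF C])
      also have "\<dots> = z" using mat_kernelD(2)[OF C v'] x C by auto
      finally show ?thesis using mat_rangeI[OF C', of "vec l (\<lambda>i. u $ ?skip i)"] by simp
    qed
    moreover have "set ?bs \<subseteq> {..m}"
    proof
      fix b assume "b \<in> set ?bs"
      then obtain i where "i < l" "b = bs ! ?skip i" by auto
      with nth_mem[OF skip] have "b \<in> set bs" by metis
      with bs show "b \<in> {..m}" by blast
    qed
    ultimately have "gen (?bs, ?M)" by (auto simp: gen_def)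
    from min[OF this] l show False by simp
  qed
  with M range bs show ?thesis by (rule that)
qed

section \<open>Ideals that contain all forms of large degree\<close>

lemma power_ideal_vars_subset: "power_ideal (\<lambda>_. 1) UNIV \<subseteq> ideal.span (range Var)"
proof
  fix f :: "('r::finite, 'k::comm_ring_1) mpol"
  assume f: "f \<in> power_ideal (\<lambda>_. 1) UNIV"
  have "Poly_Mapping.single t (Poly_Mapping.lookup f t) \<in> ideal.span (range Var)"
    if "t \<in> Poly_Mapping.keys f" for t
  proof -
    have "\<forall>t\<in>Poly_Mapping.keys f. \<exists>k\<in>UNIV. 1 \<le> Poly_Mapping.lookup t k"
      using f by (simp only: power_ideal_def mem_Collect_eq)
    then have "\<exists>k\<in>UNIV. 1 \<le> Poly_Mapping.lookup t k" using that by (rule bspec)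
    then obtain k where k: "1 \<le> Poly_Mapping.lookup t k" by (rule bexE)
    let ?e = "Poly_Mapping.single k (1::nat)"
    have "t = (t - ?e) + ?e"
      using k by (intro poly_mapping_eqI) (auto simp: lookup_add lookup_minus lookup_single when_def)
    then have "Poly_Mapping.single t (Poly_Mapping.lookup f t) =
        Poly_Mapping.single (t - ?e) (Poly_Mapping.lookup f t) * Var k"
      by (simp add: Var_def mult_single)
    then show ?thesis by (simp add: ideal.span_scale ideal.span_base)
  qed
  then have "(\<Sum>t\<in>Poly_Mapping.keys f. Poly_Mapping.single t (Poly_Mapping.lookup f t)) \<in> ideal.span (range Var)"
    by (rule ideal.span_sum)
  then show "f \<in> ideal.span (range Var)" by (simp add: mpol_eq_sum_terms[symmetric])
qed

lemma homogeneous_ideal_hcomp: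
  assumes J: "homogeneous_ideal total_degree J" and f: "f \<in> J"
  shows "hcomp d f \<in> J"
proof -
  obtain B where B: "\<And>b. b \<in> B \<Longrightarrow> \<exists>e. homogeneous total_degree e b" "J = ideal.span B"
    using J by (auto simp: homogeneous_ideal_def)
  from f show ?thesis unfolding B(2)
  proof (induction f rule: ideal.span_induct_alt)
    case base
    then show ?case by (simp add: ideal.span_zero)
  next
    case (step a b f)
    obtain e where "homogeneous total_degree e b" using B(1)[OF step(1)] by blast
    from hcomp_mult_homogeneous[OF this, of d a] have "hcomp d (a * b) = hcomp (d - e) a * b"
      by (simp add: mult.commute)
    with step show ?case by (simp add: hcomp_add ideal.span_add ideal.span_scale ideal.span_base)
  qed
qed

lemma submodule_vec_in_ideal: "ideal.subspace K \<Longrightarrow> vec_submodule n (vec_in n K)"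
  by (auto simp: vec_submodule_def vec_in_def ideal.subspace_def)

lemma homogeneous_ideal_subspace: "homogeneous_ideal deg J \<Longrightarrow> ideal.subspace J"
  by (auto simp: homogeneous_ideal_def)

text \<open>At the start \<open>J\<close> is a submodule of the free module with one basis vector of degree \<open>0\<close>. For it
  the hypothesis of \<open>tor_boundedI\<close> holds for a trivial reason, as every form \<open>h\<close> of degree at least \<open>m\<close>
  lies in \<open>J\<close> itself.\<close>

lemma m_regular_if_contains_forms:
  fixes J :: "('r::finite, 'k::field) mpol set"
  assumes J: "homogeneous_ideal total_degree J" and m: "0 \<le> m"
    and forms: "\<And>d f. m \<le> d \<Longrightarrow> homogeneous total_degree d f \<Longrightarrow> f \<in> J"
  shows "m_regular m J"
proof -
  note J_ideal = homogeneous_ideal_subspace[OF J]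
  \<comment> \<open>The state of the construction at step \<open>p\<close>: the syzygy module \<open>Z\<close> inside a free module with degrees
      \<open>cs\<close>, and a minimal homogeneous generating matrix \<open>M\<close> of \<open>Z\<close> whose columns have the degrees \<open>bs\<close>.\<close>
  define good where "good p cs Z bs M \<longleftrightarrow> graded_submodule cs Z \<and> tor_bounded (m + int p) cs Z \<and>
      (\<forall>c\<in>set cs. c \<le> m + int p) \<and> hmat cs bs 0 M \<and> mat_range M = Z \<and> set bs \<subseteq> {..m + int p} \<and>
      mat_kernel M \<subseteq> vars_vec UNIV (length bs) \<and> (p = 0 \<longrightarrow> cs = [0] \<and> Z = vec_in 1 J)"
    for p cs Z bs and M :: "('r, 'k) mpol mat"
  have start: "graded_submodule [0] (vec_in 1 J)"
    unfolding graded_submodule_def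
    using submodule_vec_in_ideal[OF J_ideal, of 1] homogeneous_ideal_hcomp[OF J]
      hvcomp_carrier[of "[0]"]
    by (auto simp: vec_in_def)
  have tor: "tor_bounded m [0] (vec_in 1 J)"
  proof (rule tor_boundedI[OF start])
    fix A :: "'r set" and h :: "('r, 'k) mpol vec" and e
    assume h: "h \<in> carrier_vec (length [0])" "hvcomp [0] e h = h" "m \<le> e"
    have "h $ 0 \<in> J"
    proof (rule forms[OF h(3)])
      show "homogeneous total_degree e (h $ 0)"
        using arg_cong[OF h(2), of "\<lambda>v. v $ 0"] by (simp add: homogeneous_iff_hcomp)
    qed
    then have "h - 0\<^sub>v 1 \<in> vec_in 1 J" using h(1) by (auto simp: vec_in_def)
    moreover have "hvcomp [0] e (0\<^sub>v 1) = (0\<^sub>v 1 :: ('r, 'k) mpol vec)" using hvcomp_0[of "[0]"] by simp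
    moreover have "0\<^sub>v 1 \<in> vars_vec A (length [0])" using submoduleD(2)[OF submodule_vec_in] by simp
    ultimately show "\<exists>r'\<in>vars_vec A (length [0]). hvcomp [0] e r' = r' \<and> h - r' \<in> vec_in 1 J" by blast
  qed
  define P where "P p = (\<lambda>(cs, Z, bs, M). good p cs Z bs M)" for p
  have "\<exists>x. \<forall>p. P p (x p) \<and> (case x p of (cs, Z, bs, M) \<Rightarrow> case x (Suc p) of (cs', Z', bs', M') \<Rightarrow>
      cs' = bs \<and> Z' = mat_kernel M)"
  proof (rule dependent_nat_choice)
    obtain bs M where "hmat [0] bs 0 M" "mat_range M = vec_in 1 J" "set bs \<subseteq> {..m}"
        "mat_kernel M \<subseteq> vars_vec UNIV (length bs)"
      using m by (auto intro: minimal_homogeneous_generators[OF start tor])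
    then have "P 0 ([0], vec_in 1 J, bs, M)" using start tor m by (auto simp: P_def good_def)
    then show "\<exists>x. P 0 x" ..
  next
    fix x p assume "P p x"
    moreover obtain cs Z bs M where x: "x = (cs, Z, bs, M)" by (cases x)
    ultimately have good: "good p cs Z bs M" by (simp add: P_def)
    let ?Z = "mat_kernel M"
    have 1: "graded_submodule bs ?Z" using good by (auto simp: good_def intro: graded_submodule_kernel)
    have 2: "tor_bounded (m + int (Suc p)) bs ?Z"
      using good tor_bounded_kernel[of cs bs M "m + int p"] by (auto simp: good_def algebra_simps)
    have 3: "c \<le> m + int (Suc p)" if "c \<in> set bs" for c using good that by (force simp: good_def)
    obtain bs' M' where "hmat bs bs' 0 M'" "mat_range M' = ?Z" "set bs' \<subseteq> {..m + int (Suc p)}"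
        "mat_kernel M' \<subseteq> vars_vec UNIV (length bs')"
      by (rule minimal_homogeneous_generators[OF 1 2 3])
    then have "good (Suc p) bs ?Z bs' M'" using 1 2 3 by (simp add: good_def)
    then show "\<exists>y. P (Suc p) y \<and> (case x of (cs, Z, bs, M) \<Rightarrow> case y of (cs', Z', bs', M') \<Rightarrow>
        cs' = bs \<and> Z' = mat_kernel M)"
      by (intro exI[of _ "(bs, ?Z, bs', M')"]) (simp add: P_def x)
  qed
  then obtain x where x: "\<forall>p. P p (x p) \<and> (case x p of (cs, Z, bs, M) \<Rightarrow>
      case x (Suc p) of (cs', Z', bs', M') \<Rightarrow> cs' = bs \<and> Z' = mat_kernel M)"
    by (rule exE)
  define b where "b p = fst (snd (snd (x p)))" for p
  define D where "D p = snd (snd (snd (x p)))" for p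
  have good: "good p (fst (x p)) (fst (snd (x p))) (b p) (D p)" for p
    using spec[OF x, of p] by (simp add: P_def b_def D_def case_prod_beta)
  have link: "fst (x (Suc p)) = b p" "fst (snd (x (Suc p))) = mat_kernel (D p)" for p
    using spec[OF x, of p] by (simp_all add: b_def D_def case_prod_beta)
  have D0: "hmat [0] (b 0) 0 (D 0)" "mat_range (D 0) = vec_in 1 J"
    using good[of 0] by (auto simp: good_def)
  have D_Suc: "hmat (b p) (b (Suc p)) 0 (D (Suc p))" "mat_range (D (Suc p)) = mat_kernel (D p)" for p
    using good[of "Suc p"] by (auto simp: good_def link)
  have ker: "mat_kernel (D p) \<subseteq> vars_vec UNIV (length (b p))" and deg: "set (b p) \<subseteq> {..m + int p}" for p
    using good[of p] by (auto simp: good_def)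
  note C0 = hmat_carrier[OF D0(1), simplified] and C = hmat_carrier[OF D_Suc(1)]
  let ?g = "row (D 0) 0"
  have g: "D 0 *\<^sub>v v = vec 1 (\<lambda>_. ?g \<bullet> v)" for v using C0 by (intro eq_vecI) auto
  have range_D: "{D (Suc p) *\<^sub>v w |w. w \<in> carrier_vec (length (b (Suc p)))} = mat_kernel (D p)" for p
    using D_Suc(2)[of p] C[of p] by (auto simp: mat_range_def)
  have "minimal_graded_free_resolution J b ?g (\<lambda>p. D (Suc p))"
    unfolding minimal_graded_free_resolution_def
  proof (intro conjI allI impI)
    show "?g \<in> carrier_vec (length (b 0))" using C0 by (intro carrier_vecI) simp
    show "D (Suc p) \<in> carrier_mat (length (b p)) (length (b (Suc p)))" for p by (rule C)
    show "homogeneous total_degree (b 0 ! j) (?g $ j)" if "j < length (b 0)" for j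
      using D0(1) C0 that by (auto simp: hmat_def)
    show "homogeneous total_degree (b (Suc p) ! j - b p ! i) (D (Suc p) $$ (i, j))"
      if "i < length (b p)" "j < length (b (Suc p))" for p i j
      using D_Suc(1)[of p] that by (simp add: hmat_def)
    show "J = {?g \<bullet> v |v. v \<in> carrier_vec (length (b 0))}"
    proof (intro equalityI subsetI)
      fix f assume "f \<in> J"
      then have "vec 1 (\<lambda>_. f) \<in> mat_range (D 0)" unfolding D0(2) by (simp add: vec_in_def)
      then obtain v where v: "v \<in> carrier_vec (length (b 0))" "vec 1 (\<lambda>_. f) = D 0 *\<^sub>v v"
        by (rule mat_rangeE[OF _ C0])
      from arg_cong[OF v(2), of "\<lambda>u. u $ 0"] have "f = ?g \<bullet> v" unfolding g by simp
      with v(1) show "f \<in> {?g \<bullet> v |v. v \<in> carrier_vec (length (b 0))}" by blast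
    next
      fix f assume "f \<in> {?g \<bullet> v |v. v \<in> carrier_vec (length (b 0))}"
      then obtain v where v: "v \<in> carrier_vec (length (b 0))" "f = ?g \<bullet> v" by blast
      from mat_rangeI[OF C0 v(1)] show "f \<in> J" unfolding D0(2) g v(2) by (simp add: vec_in_def)
    qed
    show "{v \<in> carrier_vec (length (b 0)). ?g \<bullet> v = 0} =
        {D (Suc 0) *\<^sub>v w |w. w \<in> carrier_vec (length (b 1))}"
      using range_D[of 0] unfolding mat_kernel[OF C0] g by (auto simp: vec_eq_iff)
    show "mat_kernel (D (Suc p)) =
        {D (Suc (Suc p)) *\<^sub>v w |w. w \<in> carrier_vec (length (b (Suc (Suc p))))}" for p
      by (rule range_D[symmetric])
    show "D (Suc p) $$ (i, j) \<in> ideal.span (range Var)"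
      if i: "i < length (b p)" and j: "j < length (b (Suc p))" for p i j
    proof -
      have "col (D (Suc p)) j \<in> vars_vec UNIV (length (b p))"
        using col_in_mat_range[OF C j] ker[of p] unfolding D_Suc(2) by blast
      then have "col (D (Suc p)) j $ i \<in> power_ideal (\<lambda>_. 1) UNIV" using i by (simp add: vec_in_def)
      then show ?thesis using power_ideal_vars_subset C[of p] i j by auto
    qed
  qed
  moreover have "i \<le> m + int p" if "graded_betti b p i \<noteq> 0" for p i
  proof -
    have "i \<in> set (b p)" using that by (simp add: graded_betti_def count_list_0_iff)
    with deg[of p] show ?thesis by auto
  qed
  ultimately show ?thesis unfolding m_regular_def by blast
qed

section \<open>The specialization homomorphism\<close>

lemma power_single_mpol:
  "(Const l * Var k) ^ n = Poly_Mapping.single (Poly_Mapping.single k n) (l ^ n :: 'k::comm_ring_1)"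
proof (induction n)
  case (Suc n)
  then show ?case by (simp add: Const_def Var_def mult_single single_add[symmetric])
qed simp

lemma prod_single_mpol:
  "finite A \<Longrightarrow> (\<Prod>x\<in>A. Poly_Mapping.single (u x) (l x)) =
    (Poly_Mapping.single (\<Sum>x\<in>A. u x) (\<Prod>x\<in>A. l x) :: ('x, 'k::comm_ring_1) mpol)"
  by (induction A rule: finite_induct) (simp_all add: mult_single)

text \<open>Up to a scalar the image of a monomial depends on its multidegree only; this is why images of
  multihomogeneous polynomials are scalar multiples of monomials.\<close>

lemma specialize_single_eq:
  "specialize c lam (Poly_Mapping.single t a) =
    Poly_Mapping.single (multidegree c t) (a * (\<Prod>x\<in>UNIV. lam x ^ Poly_Mapping.lookup t x))"
  by (simp add: specialize_single power_single_mpol prod_single_mpol multidegree_def)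
    (simp add: Const_def mult_single)

lemma total_degree_sum: "total_degree (\<Sum>x\<in>A. u x) = (\<Sum>x\<in>A. total_degree (u x))"
  by (induction A rule: infinite_finite_induct) (simp_all add: total_degree_add)

lemma total_degree_multidegree:
  fixes c :: "'x::finite \<Rightarrow> 'r::finite"
  shows "total_degree (multidegree c t) = total_degree t"
  by (simp add: multidegree_def total_degree_sum total_degree_single) (simp add: total_degree_def)

interpretation specialize: comm_ring_hom "specialize c lam"
proof
  show "specialize c lam 1 = 1"
    using specialize_Const[of c lam 1] by (simp add: Const_def)
qed (simp_all add: specialize_0 specialize_add specialize_mult)

lemma specialize_eq_sum:
  "specialize c lam f = (\<Sum>t\<in>Poly_Mapping.keys f. Poly_Mapping.single (multidegree c t)
    (Poly_Mapping.lookup f t * (\<Prod>x\<in>UNIV. lam x ^ Poly_Mapping.lookup t x)))"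
proof -
  have "specialize c lam f = (\<Sum>t\<in>Poly_Mapping.keys f.
      specialize c lam (Poly_Mapping.single t (Poly_Mapping.lookup f t)))"
    unfolding specialize.hom_sum[symmetric] mpol_eq_sum_terms[symmetric] ..
  then show ?thesis by (simp add: specialize_single_eq)
qed

lemma specialize_multihomogeneous:
  fixes f :: "('x::finite, 'k::field) mpol"
  assumes "homogeneous (multidegree c) u f"
  obtains a where "specialize c lam f = Poly_Mapping.single u a"
proof -
  have "specialize c lam f = (\<Sum>t\<in>Poly_Mapping.keys f. Poly_Mapping.single u
      (Poly_Mapping.lookup f t * (\<Prod>x\<in>UNIV. lam x ^ Poly_Mapping.lookup t x)))"
    unfolding specialize_eq_sum[of c lam f] using assms by (intro sum.cong) (auto simp: homogeneous_def)
  moreover have "(\<Sum>t\<in>T. Poly_Mapping.single u (l t)) = Poly_Mapping.single u (\<Sum>t\<in>T. l t)" for T and l :: "('x \<Rightarrow>\<^sub>0 nat) \<Rightarrow> 'k"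
    by (induction T rule: infinite_finite_induct) (simp_all add: single_add)
  ultimately have "specialize c lam f = Poly_Mapping.single u (\<Sum>t\<in>Poly_Mapping.keys f.
      Poly_Mapping.lookup f t * (\<Prod>x\<in>UNIV. lam x ^ Poly_Mapping.lookup t x))" by simp
  then show ?thesis by (rule that)
qed

lemma homogeneous_specialize:
  fixes c :: "'x::finite \<Rightarrow> 'r::finite"
  assumes "homogeneous total_degree d f"
  shows "homogeneous total_degree d (specialize c lam f)"
proof -
  have "hcomp d (specialize c lam f) = specialize c lam f"
    unfolding specialize_eq_sum hcomp_sum using assms
    by (intro sum.cong) (auto simp: hcomp_single total_degree_multidegree homogeneous_def)
  then show ?thesis by (simp add: homogeneous_iff_hcomp)
qed

lemma hmat_specialize:
  fixes c :: "'x::finite \<Rightarrow> 'r::finite"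
  assumes "hmat cs bs d M"
  shows "hmat cs bs d (map_mat (specialize c lam) M)"
  using assms by (auto simp: hmat_def homogeneous_specialize)

text \<open>The image of a form of pure color \<open>i\<close> can be nonzero only if some variable \<open>x\<close> of color \<open>i\<close> has
  \<open>lam x \<noteq> 0\<close>. With one such variable for each color every monomial has a preimage.\<close>

lemma surj_specialize:
  fixes c :: "'x::finite \<Rightarrow> 'r::finite" and lam :: "'x \<Rightarrow> 'k::field"
  assumes "\<And>i. \<exists>f. pure_color c i f \<and> specialize c lam f \<noteq> 0"
  shows "surj (specialize c lam)"
proof -
  have "\<exists>x. c x = i \<and> lam x \<noteq> 0" for i
  proof -
    obtain f where "pure_color c i f" and nz: "specialize c lam f \<noteq> 0" using assms by blast
    then obtain n where n: "n > 0" "homogeneous (multidegree c) (Poly_Mapping.single i n) f"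
      by (auto simp: pure_color_def)
    from nz obtain t where t: "t \<in> Poly_Mapping.keys f" "(\<Prod>x\<in>UNIV. lam x ^ Poly_Mapping.lookup t x) \<noteq> 0"
      unfolding specialize_eq_sum by (metis (no_types, lifting) mult_zero_right single_zero sum.neutral)
    have "Poly_Mapping.lookup (multidegree c t) i = n" using n(2) t(1) by (simp add: homogeneous_def)
    then have "(\<Sum>x\<in>UNIV. Poly_Mapping.lookup t x when c x = i) \<noteq> 0"
      using n(1) by (simp add: multidegree_def lookup_sum lookup_single)
    then obtain x where "(Poly_Mapping.lookup t x when c x = i) \<noteq> 0"
      using sum.not_neutral_contains_not_neutral by blast
    then have "c x = i" "Poly_Mapping.lookup t x \<noteq> 0" by (auto simp: when_def split: if_splits)
    moreover have "lam x ^ Poly_Mapping.lookup t x \<noteq> 0" using t(2) by (simp add: prod_zero_iff)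
    ultimately show ?thesis by (metis power_eq_0_iff neq0_conv)
  qed
  then obtain x where x: "\<And>i. c (x i) = i" "\<And>i. lam (x i) \<noteq> 0" by metis
  have "f \<in> range (specialize c lam)" for f
  proof (induction f rule: mpol_induct)
    case zero
    show ?case by (rule range_eqI[of _ _ 0]) (simp add: specialize_0)
  next
    case (add_single f t a)
    let ?s = "\<Sum>i\<in>UNIV. Poly_Mapping.single (x i) (Poly_Mapping.lookup t i)"
    let ?l = "\<Prod>z\<in>UNIV. lam z ^ Poly_Mapping.lookup ?s z"
    have inj: "inj x" by (metis injI x(1))
    have s: "Poly_Mapping.lookup ?s z = (if z \<in> range x then Poly_Mapping.lookup t (c z) else 0)" for z
    proof -
      have "Poly_Mapping.lookup ?s z = (\<Sum>i\<in>UNIV. if i = c z \<and> z \<in> range x then Poly_Mapping.lookup t i else 0)"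
        unfolding lookup_sum lookup_single when_def using x(1) by (intro sum.cong) auto
      then show ?thesis by simp
    qed
    have "multidegree c ?s = (\<Sum>z\<in>range x. Poly_Mapping.single (c z) (Poly_Mapping.lookup t (c z)))"
      unfolding multidegree_def s by (intro sum.mono_neutral_cong_right) auto
    also have "\<dots> = (\<Sum>i\<in>UNIV. Poly_Mapping.single i (Poly_Mapping.lookup t i))"
      by (simp add: sum.reindex[OF inj] x(1))
    also have "\<dots> = t"
      by (intro poly_mapping_eqI) (simp add: lookup_sum lookup_single when_def)
    finally have "multidegree c ?s = t" .
    moreover have "?l \<noteq> 0" unfolding s using x(2) by auto
    ultimately have "specialize c lam (Poly_Mapping.single ?s (a / ?l)) = Poly_Mapping.single t a"
      by (simp add: specialize_single_eq)
    moreover from add_single obtain f' where "f = specialize c lam f'" by (rule rangeE)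
    ultimately have "Poly_Mapping.single t a + f = specialize c lam (Poly_Mapping.single ?s (a / ?l) + f')"
      by (simp only: specialize_add)
    then show ?case by (rule range_eqI)
  qed
  then show ?thesis by (rule UNIV_eq_I[symmetric])
qed

section \<open>Images of multigraded ideals are monomial\<close>

lemma ideal_gen_in_add:
  assumes A: "0 \<in> A" "\<And>a b. a \<in> A \<Longrightarrow> b \<in> A \<Longrightarrow> a + b \<in> A"
    and f: "f \<in> ideal_gen_in A G" and g: "g \<in> ideal_gen_in A G"
  shows "f + g \<in> ideal_gen_in A G"
proof -
  obtain F a where F: "f = (\<Sum>x\<in>F. a x * x)" "finite F" "F \<subseteq> G" "a ` F \<subseteq> A"
    using f by (auto simp: ideal_gen_in_def)
  obtain H b where H: "g = (\<Sum>x\<in>H. b x * x)" "finite H" "H \<subseteq> G" "b ` H \<subseteq> A"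
    using g by (auto simp: ideal_gen_in_def)
  let ?c = "\<lambda>x. (if x \<in> F then a x else 0) + (if x \<in> H then b x else 0)"
  have "f = (\<Sum>x\<in>F \<union> H. (if x \<in> F then a x else 0) * x)"
    unfolding F(1) by (rule sum.mono_neutral_cong_left) (use F H in auto)
  moreover have "g = (\<Sum>x\<in>F \<union> H. (if x \<in> H then b x else 0) * x)"
    unfolding H(1) by (rule sum.mono_neutral_cong_left) (use F H in auto)
  ultimately have "f + g = (\<Sum>x\<in>F \<union> H. ?c x * x)" by (simp add: sum.distrib distrib_right)
  moreover have "?c ` (F \<union> H) \<subseteq> A" using F(4) H(4) A by (auto simp: image_subset_iff)
  moreover have "finite (F \<union> H)" "F \<union> H \<subseteq> G" using F(2,3) H(2,3) by auto
  ultimately show ?thesis unfolding ideal_gen_in_def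
    by (intro CollectI exI[of _ "F \<union> H"] exI[of _ ?c] conjI)
qed

text \<open>The images of multihomogeneous generators of \<open>I\<close> are scalar multiples of monomials. The
  monomials that occur with a nonzero scalar generate the image; they lie in the image because \<open>I\<close> is
  closed under multiplication by scalars.\<close>

lemma specialize_image_monomial:
  fixes c :: "'x::finite \<Rightarrow> 'r" and lam :: "'x \<Rightarrow> 'k::field"
  assumes I: "homogeneous_ideal (multidegree c) I"
  shows "monomial_ideal_in (range (specialize c lam)) (specialize c lam ` I)"
    and "monomial_ideal (ideal.span (specialize c lam ` I))"
proof -
  let ?p = "specialize c lam"
  obtain B where B: "\<And>b. b \<in> B \<Longrightarrow> \<exists>u. homogeneous (multidegree c) u b" "I = ideal.span B"
    using I by (auto simp: homogeneous_ideal_def)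
  define G :: "('r, 'k) mpol set" where "G = {Poly_Mapping.single u 1 | u. \<exists>b\<in>B. \<exists>a. a \<noteq> 0 \<and> ?p b = Poly_Mapping.single u a}"
  have G_image: "G \<subseteq> ?p ` I"
  proof
    fix g assume "g \<in> G"
    then obtain u b a where g: "g = Poly_Mapping.single u 1" "b \<in> B" "a \<noteq> 0" "?p b = Poly_Mapping.single u a"
      by (auto simp: G_def)
    have "?p (Const (1 / a) * b) = g"
      using g by (simp add: specialize_mult specialize_Const) (simp add: Const_def mult_single)
    moreover have "Const (1 / a) * b \<in> I" unfolding B(2) using g(2) by (intro ideal.span_scale ideal.span_base)
    ultimately show "g \<in> ?p ` I" by blast
  qed
  have "G \<subseteq> monomials" by (auto simp: G_def monomials_def)
  moreover have "G \<subseteq> range ?p" using G_image by (rule order_trans) auto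
  ultimately have G: "G \<subseteq> monomials \<inter> range ?p" by simp
  have "0 \<in> range ?p" by (rule range_eqI[of _ _ 0]) (simp add: specialize_0)
  moreover have "u + v \<in> range ?p" if "u \<in> range ?p" "v \<in> range ?p" for u v
    using that by (auto simp: specialize_add[symmetric])
  ultimately have add: "f + g \<in> ideal_gen_in (range ?p) G"
    if "f \<in> ideal_gen_in (range ?p) G" "g \<in> ideal_gen_in (range ?p) G"
    for f g :: "('r, 'k) mpol"
    using that by (intro ideal_gen_in_add)
  have zero: "0 \<in> ideal_gen_in (range ?p) G"
    unfolding ideal_gen_in_def by (auto intro!: exI[of _ "{}"])
  have "?p f \<in> ideal_gen_in (range ?p) G" if "f \<in> I" for f
    using that unfolding B(2)
  proof (induction f rule: ideal.span_induct_alt)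
    case base
    show ?case using zero by (simp add: specialize_0)
  next
    case (step s b f)
    obtain u where "homogeneous (multidegree c) u b" using B(1)[OF step(1)] by blast
    then obtain a where a: "?p b = Poly_Mapping.single u a" by (rule specialize_multihomogeneous)
    have "?p s * ?p b \<in> ideal_gen_in (range ?p) G"
    proof (cases "a = 0")
      case True
      then show ?thesis using a zero by simp
    next
      case False
      let ?g = "Poly_Mapping.single u 1 :: ('r, 'k) mpol"
      have g: "?g \<in> G" using False a step(1) by (auto simp: G_def)
      have "?p b = Const a * ?g" unfolding a by (simp add: Const_def mult_single)
      then have "?p s * ?p b = ?p (s * Const a) * ?g"
        by (simp only: specialize_mult specialize_Const mult.assoc)
      then obtain r where "r \<in> range ?p" "?p s * ?p b = r * ?g" by blast
      with g show ?thesis unfolding ideal_gen_in_def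
        by (intro CollectI exI[of _ "{?g}"] exI[of _ "\<lambda>_. r"]) simp
    qed
    then show ?case using add step(2) by (simp add: specialize_add specialize_mult)
  qed
  moreover have "f \<in> ?p ` I" if f: "f \<in> ideal_gen_in (range ?p) G" for f :: "('r, 'k) mpol"
  proof -
    obtain F a where F: "f = (\<Sum>x\<in>F. a x * x)" "finite F" "F \<subseteq> G" "a ` F \<subseteq> range ?p"
      using f by (auto simp: ideal_gen_in_def)
    have "\<forall>x\<in>F. \<exists>s. s \<in> I \<and> ?p s = a x * x"
    proof
      fix x assume x: "x \<in> F"
      have "x \<in> ?p ` I" by (rule subsetD[OF G_image subsetD[OF F(3) x]])
      then obtain s where s: "s \<in> I" "?p s = x" by auto
      have "a x \<in> range ?p" by (rule subsetD[OF F(4) imageI[OF x]])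
      then obtain r where r: "?p r = a x" by auto
      have "r * s \<in> I" using s(1) unfolding B(2) by (rule ideal.span_scale)
      moreover have "?p (r * s) = a x * x" by (simp add: specialize_mult s r)
      ultimately show "\<exists>s. s \<in> I \<and> ?p s = a x * x" by blast
    qed
    then obtain s where s: "\<And>x. x \<in> F \<Longrightarrow> s x \<in> I \<and> ?p (s x) = a x * x" by metis
    have "(\<Sum>x\<in>F. s x) \<in> I" unfolding B(2) using s B(2) by (intro ideal.span_sum) auto
    moreover have "?p (\<Sum>x\<in>F. s x) = f" unfolding F(1) specialize.hom_sum using s by (intro sum.cong) auto
    ultimately show ?thesis by blast
  qed
  ultimately have eq: "?p ` I = ideal_gen_in (range ?p) G" by blast
  show "monomial_ideal_in (range ?p) (?p ` I)" unfolding monomial_ideal_in_def using G eq by blast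
  have "?p ` I \<subseteq> ideal.span G"
    unfolding eq ideal_gen_in_UNIV[symmetric] by (auto simp: ideal_gen_in_def)
  then have "ideal.span (?p ` I) = ideal.span G"
    using ideal.span_minimal[OF _ ideal.subspace_span] ideal.span_mono[OF G_image] by blast
  then show "monomial_ideal (ideal.span (?p ` I))" unfolding monomial_ideal_def using G by blast
qed

section \<open>The regularity bound\<close>

lemma minimal_graded_free_resolutionD:
  assumes "minimal_graded_free_resolution I b g \<phi>"
  shows "g \<in> carrier_vec (length (b 0))"
    and "\<forall>p. \<phi> p \<in> carrier_mat (length (b p)) (length (b (Suc p)))"
    and "\<forall>j < length (b 0). homogeneous total_degree (b 0 ! j) (g $ j)"
    and "\<forall>p. \<forall>i < length (b p). \<forall>j < length (b (Suc p)).
      homogeneous total_degree (b (Suc p) ! j - b p ! i) (\<phi> p $$ (i, j))"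
    and "I = {g \<bullet> v | v. v \<in> carrier_vec (length (b 0))}"
    and "{v \<in> carrier_vec (length (b 0)). g \<bullet> v = 0} =
      {\<phi> 0 *\<^sub>v w | w. w \<in> carrier_vec (length (b 1))}"
    and "\<forall>p. mat_kernel (\<phi> p) =
      {\<phi> (Suc p) *\<^sub>v w | w. w \<in> carrier_vec (length (b (Suc (Suc p))))}"
  using assms unfolding minimal_graded_free_resolution_def by - (elim conjE, assumption)+

text \<open>If all generators had negative degree they would vanish.\<close>

lemma m_regular_nonneg:
  assumes "m_regular m I" "f \<in> I" "f \<noteq> 0"
  shows "0 \<le> m"
proof (rule ccontr)
  assume m: "\<not> 0 \<le> m"
  obtain b g \<phi> where res: "minimal_graded_free_resolution I b g \<phi>"
    and deg: "\<And>p i. graded_betti b p i \<noteq> 0 \<Longrightarrow> i \<le> m + int p"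
    using assms(1) by (auto simp: m_regular_def)
  note g = minimal_graded_free_resolutionD(1)[OF res] and I = minimal_graded_free_resolutionD(5)[OF res]
    and hom = minimal_graded_free_resolutionD(3)[OF res, rule_format]
  have "g $ j = 0" if j: "j < length (b 0)" for j
  proof -
    have "b 0 ! j \<le> m" using deg[of 0 "b 0 ! j"] j by (simp add: graded_betti_def count_list_0_iff)
    then have "hcomp (b 0 ! j) (g $ j) = 0" using m by (intro hcomp_neg) simp
    with hom[OF j] show ?thesis by (simp add: homogeneous_iff_hcomp)
  qed
  then have "g = 0\<^sub>v (length (b 0))" using g by (intro eq_vecI) auto
  then show False using assms(2,3) I by auto
qed

text \<open>The resolution of \<open>I\<close> is prolonged by \<open>F\<^sub>0 \<rightarrow> S\<close> to a resolution of \<open>S/I\<close>, which shifts the homological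
  degree by one; the homotopies are computed over \<open>S\<close> and then specialized. Surjectivity of the
  specialization makes the image of \<open>I\<close> an ideal.\<close>

lemma forms_in_specialize_image:
  fixes c :: "'x::finite \<Rightarrow> 'r::finite" and lam :: "'x \<Rightarrow> 'k::field"
  assumes reg: "m_regular m I" and I: "ideal.subspace I" and surj: "surj (specialize c lam)"
    and f: "\<And>i. f i \<in> I" "\<And>i. homogeneous total_degree (int (a i)) (f i)"
      "\<And>i. specialize c lam (f i) = vpow i (a i)"
    and d: "m \<le> d" and w: "homogeneous total_degree d w"
  shows "w \<in> specialize c lam ` I"
proof -
  let ?p = "specialize c lam"
  obtain b g \<phi> where res: "minimal_graded_free_resolution I b g \<phi>"
    and deg: "\<And>p i. graded_betti b p i \<noteq> 0 \<Longrightarrow> i \<le> m + int p"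
    using reg by (auto simp: m_regular_def)
  \<comment> \<open>The resolution of \<open>S/I\<close>, with the free module \<open>S\<close> in homological degree \<open>0\<close>.\<close>
  define B where "B = case_nat [0] b"
  define D where "D = case_nat (mat 1 (length (b 0)) (\<lambda>(i, j). g $ j)) \<phi>"
  have B: "B 0 = [0]" "\<And>p. B (Suc p) = b p" and D_Suc: "\<And>p. D (Suc p) = \<phi> p"
    by (simp_all add: B_def D_def)
  note g = minimal_graded_free_resolutionD(1)[OF res] and I_eq = minimal_graded_free_resolutionD(5)[OF res]
    and hom_g = minimal_graded_free_resolutionD(3)[OF res, rule_format]
    and \<phi> = minimal_graded_free_resolutionD(2)[OF res, rule_format]
    and hom_\<phi> = minimal_graded_free_resolutionD(4)[OF res, rule_format]
    and ker_g = minimal_graded_free_resolutionD(6)[OF res]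
    and ker_\<phi> = minimal_graded_free_resolutionD(7)[OF res, rule_format]
  have D: "hmat (B p) (B (Suc p)) 0 (D p)" for p
    by (cases p) (auto simp: hmat_def B_def D_def hom_g hom_\<phi> \<phi>[THEN carrier_matD(1)] \<phi>[THEN carrier_matD(2)])
  note C = hmat_carrier[OF D]
  have D0: "D 0 *\<^sub>v v = vec 1 (\<lambda>_. g \<bullet> v)" if "v \<in> carrier_vec (length (b 0))" for v
  proof -
    have "row (D 0) 0 = g" using g by (intro eq_vecI) (auto simp: D_def)
    then show ?thesis by (intro eq_vecI) (auto simp: D_def)
  qed
  have exact: "mat_kernel (D p) = mat_range (D (Suc p))" for p
  proof (cases p)
    case 0
    have "mat_kernel (D 0) = {v \<in> carrier_vec (length (b 0)). g \<bullet> v = 0}"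
      using C[of 0] D0 by (auto simp: mat_kernel[OF C] B vec_eq_iff)
    then show ?thesis unfolding ker_g using 0 \<phi>[of 0] by (auto simp: mat_range_def D_Suc)
  next
    case (Suc q)
    then show ?thesis using ker_\<phi>[of q] \<phi>[of "Suc q"] by (auto simp: mat_range_def D_Suc)
  qed
  have range_D0: "mat_range (D 0) = vec_in 1 I"
  proof (intro equalityI subsetI)
    fix v assume "v \<in> mat_range (D 0)"
    then obtain u where "u \<in> carrier_vec (length (b 0))" "v = D 0 *\<^sub>v u" using C[of 0] B by (metis mat_rangeE)
    then show "v \<in> vec_in 1 I" using D0 I_eq by (auto simp: vec_in_def)
  next
    fix v assume v: "v \<in> vec_in 1 I"
    then obtain u where u: "u \<in> carrier_vec (length (b 0))" "v $ 0 = g \<bullet> u" using I_eq by (auto simp: vec_in_def)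
    then have "v = D 0 *\<^sub>v u" using v D0 by (intro eq_vecI) (auto simp: vec_in_def)
    then show "v \<in> mat_range (D 0)" using mat_rangeI[OF C, of u 0] u(1) B by simp
  qed
  have "\<exists>s. (\<forall>p. hmat (B (Suc p)) (B p) (int (a i)) (s p)) \<and> D 0 * s 0 = f i \<cdot>\<^sub>m 1\<^sub>m (length (B 0)) \<and>
      (\<forall>p. D (Suc p) * s (Suc p) + s p * D p = f i \<cdot>\<^sub>m 1\<^sub>m (length (B (Suc p))))" for i
  proof -
    have "col (f i \<cdot>\<^sub>m 1\<^sub>m (length (B 0))) j \<in> mat_range (D 0)" if "j < length (B 0)" for j
      unfolding range_D0 using that f(1)[of i] by (auto simp: B vec_in_def)
    from null_homotopy[OF D exact f(2)[of i] this] show ?thesis by metis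
  qed
  then obtain s where s: "\<And>i p. hmat (B (Suc p)) (B p) (int (a i)) (s i p)"
      "\<And>i. D 0 * s i 0 = f i \<cdot>\<^sub>m 1\<^sub>m (length (B 0))"
      "\<And>i p. D (Suc p) * s i (Suc p) + s i p * D p = f i \<cdot>\<^sub>m 1\<^sub>m (length (B (Suc p)))"
    by metis
  note Cs = hmat_carrier[OF s(1)]
  let ?h = "map_mat ?p"
  have h_one: "?h (f i \<cdot>\<^sub>m 1\<^sub>m n) = vpow i (a i) \<cdot>\<^sub>m 1\<^sub>m n" for i n
    by (intro eq_matI) (auto simp: f(3) specialize_0 specialize.hom_one)
  have "vec 1 (\<lambda>_. w) \<in> mat_range (?h (D 0))"
  proof (rule socle_degree_bound[where s = "\<lambda>k p. ?h (s k p)" and a = a and B = B and D = "\<lambda>p. ?h (D p)" and d = d])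
    show "hmat (B p) (B (Suc p)) 0 (?h (D p))" for p by (rule hmat_specialize[OF D])
    show "hmat (B (Suc p)) (B p) (int (a k)) (?h (s k p))" for k p by (rule hmat_specialize[OF s(1)])
    show "?h (D p) * ?h (D (Suc p)) = 0\<^sub>m (length (B p)) (length (B (Suc (Suc p))))" for p
    proof -
      have "D p * D (Suc p) = 0\<^sub>m (length (B p)) (length (B (Suc (Suc p))))"
        by (rule mult_eq_0_if_exact[OF C C exact])
      then show ?thesis unfolding specialize.mat_hom_mult[OF C C, symmetric]
        by (auto intro!: eq_matI simp: specialize_0)
    qed
    show "?h (D 0) * ?h (s k 0) = vpow k (a k) \<cdot>\<^sub>m 1\<^sub>m (length (B 0))" for k
      unfolding specialize.mat_hom_mult[OF C Cs, symmetric] s(2) by (rule h_one)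
    show "?h (D (Suc p)) * ?h (s k (Suc p)) + ?h (s k p) * ?h (D p) = vpow k (a k) \<cdot>\<^sub>m 1\<^sub>m (length (B (Suc p)))"
      for k p
    proof -
      have "?h (D (Suc p) * s k (Suc p)) + ?h (s k p * D p) = ?h (D (Suc p) * s k (Suc p) + s k p * D p)"
        using C[of p] C[of "Suc p"] Cs[of k p] Cs[of k "Suc p"]
        by (intro eq_matI) (auto simp: specialize_add simp del: index_mult_mat(1))
      then show ?thesis
        unfolding specialize.mat_hom_mult[OF C Cs, symmetric] specialize.mat_hom_mult[OF Cs C, symmetric]
        by (simp add: s(3) h_one)
    qed
    show "vec 1 (\<lambda>_. w) \<in> carrier_vec (length (B 0))" by (simp add: B)
    show "hvcomp (B 0) d (vec 1 (\<lambda>_. w)) = vec 1 (\<lambda>_. w)"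
      using w by (intro eq_vecI) (auto simp: B homogeneous_iff_hcomp)
    show "e < d + int (card (UNIV :: 'r set))" if "e \<in> set (B (card (UNIV :: 'r set)))" for e
    proof -
      \<comment> \<open>There is at least one color, so homological degree \<open>r\<close> belongs to the resolution of \<open>I\<close>.\<close>
      obtain q where q: "card (UNIV :: 'r set) = Suc q" by (metis card_eq_0_iff finite UNIV_not_empty old.nat.exhaust)
      with that have "e \<in> set (b q)" by (simp add: B)
      then have "e \<le> m + int q" using deg[of q e] by (simp add: graded_betti_def count_list_0_iff)
      with d q show ?thesis by simp
    qed
  qed
  moreover have "mat_range (?h (D 0)) \<subseteq> vec_in 1 (?p ` I)"
  proof -
    have "ideal.subspace (?p ` I)"
      unfolding ideal.subspace_def
    proof (intro conjI ballI allI)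
      show "0 \<in> ?p ` I" using ideal.subspace_0[OF I] specialize_0[of c lam] by (metis imageI)
      fix u assume "u \<in> ?p ` I"
      then obtain u' where u': "u' \<in> I" "u = ?p u'" by blast
      show "u + v \<in> ?p ` I" if "v \<in> ?p ` I" for v
      proof -
        obtain v' where v': "v' \<in> I" "v = ?p v'" using \<open>v \<in> ?p ` I\<close> by blast
        have "u + v = ?p (u' + v')" using u' v' by (simp add: specialize_add)
        with ideal.subspace_add[OF I u'(1) v'(1)] show ?thesis by blast
      qed
      show "r * u \<in> ?p ` I" for r
      proof -
        obtain r' where "r = ?p r'" using surj by blast
        then have "r * u = ?p (r' * u')" using u' by (simp add: specialize_mult)
        with ideal.subspace_scale[OF I u'(1), of r'] show ?thesis by blast
      qed
    qed
    then have W: "vec_submodule 1 (vec_in 1 (?p ` I))" by (rule submodule_vec_in_ideal)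
    have C0: "D 0 \<in> carrier_mat 1 (length (b 0))" using C[of 0] by (simp add: B)
    have "col (?h (D 0)) j \<in> vec_in 1 (?p ` I)" if j: "j < length (b 0)" for j
    proof -
      have "col (D 0) j \<in> vec_in 1 I" using col_in_mat_range[OF C0 j] by (simp add: range_D0)
      then show ?thesis using C0 j by (auto simp: vec_in_def)
    qed
    moreover have "?h (D 0) \<in> carrier_mat 1 (length (b 0))" using C0 by simp
    ultimately show ?thesis using range_subset_submodule[OF _ W] by (auto simp: mat_range_def)
  qed
  ultimately show ?thesis by (auto simp: vec_in_def)
qed

theorem theorem4p7:
  fixes c :: "'x::finite \<Rightarrow> 'r::finite"
    and I :: "('x, 'k::field) mpol set"
  assumes "homogeneous_ideal (multidegree c) I"
    and "\<forall>i. \<exists>f\<in>I. pure_color c i f"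
  shows "(\<forall>lam :: 'x \<Rightarrow> 'k.
           monomial_ideal_in (range (specialize c lam)) (specialize c lam ` I) \<and>
           monomial_ideal (ideal.span (specialize c lam ` I))) \<and>
         (\<forall>lam :: 'x \<Rightarrow> 'k. (\<forall>i. \<exists>f\<in>I. pure_color c i f \<and> specialize c lam f \<noteq> 0) \<longrightarrow>
           monomial_ideal (specialize c lam ` I) \<and>
           (\<forall>J :: ('r, 'k) mpol set.
              homogeneous_ideal total_degree J \<and> specialize c lam ` I \<subseteq> J \<longrightarrow>
              regularity J \<le> regularity I))"
proof (intro conjI allI impI)
  fix lam :: "'x \<Rightarrow> 'k"
  let ?p = "specialize c lam"
  show *: "monomial_ideal_in (range ?p) (?p ` I)" and "monomial_ideal (ideal.span (?p ` I))"
    using specialize_image_monomial[OF assms(1)] by blast+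
  note I = homogeneous_ideal_subspace[OF assms(1)]
  assume general: "\<forall>i. \<exists>f\<in>I. pure_color c i f \<and> ?p f \<noteq> 0"
  then have surj: "surj ?p" by (intro surj_specialize) blast
  then show "monomial_ideal (?p ` I)"
    using * unfolding monomial_ideal_in_def monomial_ideal_def by (auto simp: ideal_gen_in_UNIV)
  fix J :: "('r, 'k) mpol set"
  assume J: "homogeneous_ideal total_degree J \<and> ?p ` I \<subseteq> J"
  have "\<exists>a f. f \<in> I \<and> homogeneous total_degree (int a) f \<and> ?p f = vpow i a" for i
  proof -
    obtain f n where f: "f \<in> I" "?p f \<noteq> 0" "homogeneous (multidegree c) (Poly_Mapping.single i n) f"
      using spec[OF general, of i] unfolding pure_color_def by blast
    obtain a where a: "?p f = Poly_Mapping.single (Poly_Mapping.single i n) a"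
      using f(3) by (rule specialize_multihomogeneous)
    with f(2) have "a \<noteq> 0" by auto
    have "total_degree t = int n" if "t \<in> Poly_Mapping.keys f" for t
      using f(3) that total_degree_multidegree[of c t] total_degree_single[of i n]
      by (simp add: homogeneous_def)
    then have "hcomp (int n) f = f" by (simp add: homogeneous_iff_hcomp[symmetric] homogeneous_def)
    moreover have "homogeneous total_degree 0 (Const (1 / a) :: ('x, 'k) mpol)"
      by (simp add: homogeneous_def Const_def)
    ultimately have "homogeneous total_degree (int n) (Const (1 / a) * f)"
      by (simp add: homogeneous_iff_hcomp[of "int n"] hcomp_mult_homogeneous)
    moreover have "Const (1 / a) * f \<in> I" by (rule ideal.subspace_scale[OF I f(1)])
    moreover have "?p (Const (1 / a) * f) = vpow i n"
      using \<open>a \<noteq> 0\<close> by (simp add: specialize_mult specialize_Const a) (simp add: Const_def mult_single vpow_def)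
    ultimately show ?thesis by blast
  qed
  then obtain a f where f: "\<And>i. f i \<in> I" "\<And>i. homogeneous total_degree (int (a i)) (f i)"
      "\<And>i. ?p (f i) = vpow i (a i)"
    by metis
  have "m_regular m J" if m: "m_regular m I" for m
  proof (rule m_regular_if_contains_forms)
    show "homogeneous_ideal total_degree J" using J ..
    obtain h where "h \<in> I" "h \<noteq> 0" using assms(2) by (auto simp: pure_color_def)
    then show "0 \<le> m" by (rule m_regular_nonneg[OF m])
    show "w \<in> J" if "m \<le> d" "homogeneous total_degree d w" for d w
      using forms_in_specialize_image[OF m I surj f that] J by blast
  qed
  then show "regularity J \<le> regularity I"
    unfolding regularity_def by (intro INF_superset_mono) auto
qed

end
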